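(* Let $1 \leq k \leq N$. There exists some $A > 0$ such that for every $x \in B(0,1)\setminus\{0\}$, $$(x_1^2 + |x_\perp|)^{N-2}\, |H_0(x)| \leq A\big(1 + \delta_{N,2}|\ln(|x|)|\big),$$ $$(x_1^2 + |x_\perp|)^{N-\frac{3}{2}}\, |K_0(x)| \leq A,$$ $$(x_1^2 + |x_\perp|)^{N-\frac{1+\delta_{k,1}}{2}}\, |K_k(x)| \leq A.$$
   Context: $N \geq 2$ is an integer; $x = (x_1,x_\perp)$ with $x_\perp = (x_2,\ldots,x_N)$; $\delta_{a,b}$ is the Kronecker symbol; $B(0,1)$ is the unit ball of $\mathbb{R}^N$. The Fourier transform convention is $\widehat{f}(\xi) = \int_{\mathbb{R}^N} f(x) e^{-ix\cdot\xi}\,dx$. $H_0$, $K_0$ and $K_k$ ($1 \leq k \leq N$) are the tempered distributions on $\mathbb{R}^N$ whose Fourier transforms are $$\widehat{H_0}(\xi) = \frac{\xi_1}{|\xi|^2+\xi_1^4}, \qquad \widehat{K_0}(\xi) = \frac{\xi_1^2}{|\xi|^2+\xi_1^4}, \qquad \widehat{K_k}(\xi) = \frac{\xi_k\xi_1^2}{|\xi|^2+\xi_1^4}.$$ The restrictions of these distributions to $\mathbb{R}^N \setminus \{0\}$ are continuous functions, and $H_0(x)$, $K_0(x)$, $K_k(x)$ denote the values of these functions. *)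

theory Defs
  imports "HOL-Analysis.Analysis"
begin

definition partial_deriv :: "'n::finite \<Rightarrow> (real^'n \<Rightarrow> complex) \<Rightarrow> real^'n \<Rightarrow> complex"
  where "partial_deriv j f x = frechet_derivative f (at x) (axis j 1)"

text \<open>Multi-indices are given as lists of coordinates; for smooth functions the order
  in which the coordinates are listed is irrelevant.\<close>

definition iter_partial :: "'n::finite list \<Rightarrow> (real^'n \<Rightarrow> complex) \<Rightarrow> real^'n \<Rightarrow> complex"
  where "iter_partial js f = foldr partial_deriv js f"

definition smooth :: "(real^'n::finite \<Rightarrow> complex) \<Rightarrow> bool"
  where "smooth f \<longleftrightarrow> (\<forall>js x. iter_partial js f differentiable (at x))"

definition test_functions :: "(real^'n::finite) set \<Rightarrow> (real^'n \<Rightarrow> complex) set"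
  where "test_functions U =
    {f. smooth f \<and> compact (closure {x. f x \<noteq> 0}) \<and> closure {x. f x \<noteq> 0} \<subseteq> U}"

definition schwartz :: "(real^'n::finite \<Rightarrow> complex) set"
  where "schwartz = {f. smooth f \<and>
    (\<forall>m js. bdd_above (range (\<lambda>x. (1 + norm x) ^ m * norm (iter_partial js f x))))}"

definition schwartz_seminorm ::
    "nat \<Rightarrow> 'n::finite list \<Rightarrow> (real^'n \<Rightarrow> complex) \<Rightarrow> real"
  where "schwartz_seminorm m js f = (SUP x. (1 + norm x) ^ m * norm (iter_partial js f x))"

text \<open>A distribution is a functional on all functions of which only the values on Schwartz
  functions matter. The Schwartz space being metrizable, continuity of a linear functional is
  sequential continuity at the origin.\<close>

definition tempered_distribution :: "((real^'n::finite \<Rightarrow> complex) \<Rightarrow> complex) \<Rightarrow> bool"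
  where "tempered_distribution T \<longleftrightarrow>
    (\<forall>f\<in>schwartz. \<forall>g\<in>schwartz. T (\<lambda>x. f x + g x) = T f + T g) \<and>
    (\<forall>c. \<forall>f\<in>schwartz. T (\<lambda>x. c * f x) = c * T f) \<and>
    (\<forall>F. range F \<subseteq> schwartz \<longrightarrow>
       (\<forall>m js. (\<lambda>i::nat. schwartz_seminorm m js (F i)) \<longlonglongrightarrow> 0) \<longrightarrow>
       (\<lambda>i. T (F i)) \<longlonglongrightarrow> 0)"

definition fourier :: "(real^'n::finite \<Rightarrow> complex) \<Rightarrow> real^'n \<Rightarrow> complex"
  where "fourier f \<xi> = (LINT x|lborel. f x * exp (- \<i> * complex_of_real (x \<bullet> \<xi>)))"

definition fourier_dist ::
    "((real^'n::finite \<Rightarrow> complex) \<Rightarrow> complex) \<Rightarrow> (real^'n \<Rightarrow> complex) \<Rightarrow> complex"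
  where "fourier_dist T \<phi> = T (fourier \<phi>)"

definition dist_of_fun :: "(real^'n::finite \<Rightarrow> complex) \<Rightarrow> (real^'n \<Rightarrow> complex) \<Rightarrow> complex"
  where "dist_of_fun f \<phi> = (LINT x|lborel. f x * \<phi> x)"

text \<open>The integrability clause says that the locally integrable function \<open>m\<close> acts on Schwartz
  functions, so that the right-hand side of the last clause is not the default value 0 of a
  divergent integral.\<close>

definition has_fourier_transform ::
    "((real^'n::finite \<Rightarrow> complex) \<Rightarrow> complex) \<Rightarrow> (real^'n \<Rightarrow> real) \<Rightarrow> bool"
  where "has_fourier_transform T m \<longleftrightarrow>
    tempered_distribution T \<and>
    (\<forall>\<phi>\<in>schwartz. integrable lborel (\<lambda>\<xi>. complex_of_real (m \<xi>) * \<phi> \<xi>)) \<and>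
    (\<forall>\<phi>\<in>schwartz. fourier_dist T \<phi> = dist_of_fun (\<lambda>\<xi>. complex_of_real (m \<xi>)) \<phi>)"

definition continuous_restriction ::
    "((real^'n::finite \<Rightarrow> complex) \<Rightarrow> complex) \<Rightarrow> (real^'n) set \<Rightarrow> (real^'n \<Rightarrow> complex) \<Rightarrow> bool"
  where "continuous_restriction T U h \<longleftrightarrow>
    continuous_on U h \<and> (\<forall>\<phi>\<in>test_functions U. T \<phi> = dist_of_fun h \<phi>)"

text \<open>On an open set \<open>U\<close> a continuous function representing the restriction of a distribution is
  unique on \<open>U\<close>, so the description below is proper as soon as such a function exists.\<close>

definition value_at :: "((real^'n::finite \<Rightarrow> complex) \<Rightarrow> complex) \<Rightarrow> real^'n \<Rightarrow> complex"
  where "value_at T x = (THE y. \<exists>h. continuous_restriction T (- {0}) h \<and> h x = y)"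

text \<open>The coordinates are labelled by an arbitrary finite type, and \<open>e\<close> is the label of the
  first coordinate. All symbols take the value 0 at the origin, by division by zero.\<close>

definition perp_norm :: "'n::finite \<Rightarrow> real^'n \<Rightarrow> real"
  where "perp_norm e x = sqrt (\<Sum>j\<in>UNIV - {e}. (x $ j)\<^sup>2)"

definition symbol_H0 :: "'n::finite \<Rightarrow> real^'n \<Rightarrow> real"
  where "symbol_H0 e \<xi> = \<xi> $ e / ((norm \<xi>)\<^sup>2 + (\<xi> $ e) ^ 4)"

definition symbol_K0 :: "'n::finite \<Rightarrow> real^'n \<Rightarrow> real"
  where "symbol_K0 e \<xi> = (\<xi> $ e)\<^sup>2 / ((norm \<xi>)\<^sup>2 + (\<xi> $ e) ^ 4)"

definition symbol_K :: "'n::finite \<Rightarrow> 'n \<Rightarrow> real^'n \<Rightarrow> real"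
  where "symbol_K e k \<xi> = \<xi> $ k * (\<xi> $ e)\<^sup>2 / ((norm \<xi>)\<^sup>2 + (\<xi> $ e) ^ 4)"

end

theory Submission
  imports Defs "HOL-Probability.Probability"
begin

text \<open>
  All three symbols have the form \<open>\<xi>\<^sup>q / Q\<close> with a monomial \<open>\<xi>\<^sup>q\<close> and \<open>Q = \<bar>\<xi>\<bar>\<^sup>2 + \<xi>\<^sub>e\<^sup>4\<close>, and they are treated
  together. Since \<open>1 / Q\<close> is the integral of \<open>exp (- t Q)\<close> over \<open>t > 0\<close>, the kernel should be the integral
  over \<open>t\<close> of the heat kernels with symbols \<open>\<xi>\<^sup>q exp (- t Q)\<close>. These are explicit: the exponent is a sum
  of functions of one coordinate, so a heat kernel is a product of one-dimensional oscillatory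
  integrals with the weight \<open>exp (- t s\<^sup>2)\<close>, or \<open>exp (- t (s\<^sup>2 + s\<^sup>4))\<close> for the coordinate \<open>e\<close>.

  Repeated integration by parts shows that such an integral decays rapidly in its own scale, which for
  \<open>t \<le> 1\<close> is \<open>t powr (1 / 4)\<close> for \<open>x\<^sub>e\<close> and \<open>t powr (1 / 2)\<close> for the other coordinates
  (\<open>quartic_fourier_bound\<close>). Therefore \<open>\<rho> = x\<^sub>e\<^sup>2 + \<bar>x\<^sub>\<perp>\<bar>\<close> has the scale \<open>t powr (1 / 2)\<close>, and
  the heat kernel for \<open>t \<le> 1\<close> is bounded by \<open>t powr - d\<close> times any power of \<open>t powr (1 / 2) / \<rho>\<close>, where \<open>d\<close> is a quarter of \<open>q\<^sub>e + 1\<close>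
  plus half the sum of the other \<open>q\<^sub>j + 1\<close> (\<open>heat_weight_bound\<close>). Splitting the integral over \<open>t\<close> at \<open>\<rho>\<^sup>2\<close> gives a kernel
  of size \<open>\<rho> powr (2 - 2 * d)\<close>, up to a logarithm if \<open>d = 1\<close> (\<open>kernel_bound\<close>). For the three symbols this
  is the asserted exponent, and \<open>d = 1\<close> happens only for the first one in dimension two.

  It remains to identify this kernel with the values of the distribution. A test function is the Fourier
  transform of a Schwartz function (\<open>fourier_cofourier\<close>), so the distribution acts on it through its symbol,
  and two applications of Fubini show that away from the origin it acts by integration against the kernel
  (\<open>kernel_represents\<close>). As the kernel is continuous there, it gives the values, because a continuous
  representing function is unique (\<open>continuous_restriction_unique\<close>).
\<close>

section \<open>Smooth functions and test functions\<close>

lemma partial_deriv_eqI: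
  assumes "(f has_derivative D) (at x)"
  shows "partial_deriv j f x = D (axis j 1)"
  using frechet_derivative_at[OF assms] by (simp add: partial_deriv_def)

lemma has_derivative_partial_deriv:
  assumes "f differentiable (at x)"
  shows "\<exists>D. (f has_derivative D) (at x) \<and> (\<forall>j. partial_deriv j f x = D (axis j 1))"
  using assms partial_deriv_eqI unfolding differentiable_def by blast

text \<open>Smoothness is proved by exhibiting a class of differentiable functions that contains the given
  one and is stable under all partial derivatives; this replaces formulas for iterated derivatives.\<close>

lemma smoothI:
  assumes "f \<in> S"
    and diff: "\<And>g x. g \<in> S \<Longrightarrow> g differentiable (at x)"
    and closed: "\<And>g j. g \<in> S \<Longrightarrow> partial_deriv j g \<in> S"
  shows "smooth f"
proof -
  have "iter_partial js f \<in> S" for js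
    by (induction js) (use assms in \<open>auto simp: iter_partial_def\<close>)
  then show ?thesis
    using diff unfolding smooth_def by blast
qed

lemma smooth_differentiable: "smooth f \<Longrightarrow> f differentiable (at x)"
  unfolding smooth_def by (metis iter_partial_def foldr.simps(1) id_apply)

lemma smooth_partial_deriv: "smooth f \<Longrightarrow> smooth (partial_deriv j f)"
proof -
  have "iter_partial js (partial_deriv j f) = iter_partial (js @ [j]) f" for js
    by (simp add: iter_partial_def)
  then show "smooth f \<Longrightarrow> smooth (partial_deriv j f)"
    by (simp add: smooth_def)
qed

lemma smooth_continuous_on: "smooth f \<Longrightarrow> continuous_on A f"
  by (meson continuous_at_imp_continuous_on differentiable_imp_continuous_within smooth_differentiable)

lemma partial_deriv_add:
  assumes "f differentiable (at x)" "g differentiable (at x)"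
  shows "partial_deriv j (\<lambda>x. f x + g x) x = partial_deriv j f x + partial_deriv j g x"
proof -
  obtain D E where "(f has_derivative D) (at x)" "\<And>j. partial_deriv j f x = D (axis j 1)"
    and "(g has_derivative E) (at x)" "\<And>j. partial_deriv j g x = E (axis j 1)"
    using assms[THEN has_derivative_partial_deriv] by blast
  then show ?thesis
    by (simp add: partial_deriv_eqI[OF has_derivative_add])
qed

lemma partial_deriv_cmult:
  assumes "f differentiable (at x)"
  shows "partial_deriv j (\<lambda>x. c * f x) x = c * partial_deriv j f x"
proof -
  obtain D where "(f has_derivative D) (at x)" "\<And>j. partial_deriv j f x = D (axis j 1)"
    using assms[THEN has_derivative_partial_deriv] by blast
  then show ?thesis
    by (simp add: partial_deriv_eqI[OF has_derivative_mult_right])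
qed

lemma has_derivative_coord_mult:
  fixes f :: "real^'n::finite \<Rightarrow> complex"
  assumes "(f has_derivative D) (at x)"
  shows "((\<lambda>x. complex_of_real (x $ i) * f x) has_derivative
     (\<lambda>h. complex_of_real (x $ i) * D h + complex_of_real (h $ i) * f x)) (at x)"
  by (auto intro!: derivative_eq_intros assms bounded_linear_imp_has_derivative bounded_linear_intros
      simp: algebra_simps)

lemma partial_deriv_coord_mult:
  fixes f :: "real^'n::finite \<Rightarrow> complex"
  assumes "f differentiable (at x)"
  shows "partial_deriv j (\<lambda>x. complex_of_real (x $ i) * f x) x
    = complex_of_real (x $ i) * partial_deriv j f x + of_bool (i = j) * f x"
proof -
  obtain D where "(f has_derivative D) (at x)" "\<And>j. partial_deriv j f x = D (axis j 1)"
    using assms[THEN has_derivative_partial_deriv] by blast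
  then show ?thesis
    by (simp add: partial_deriv_eqI[OF has_derivative_coord_mult]) (simp add: axis_def)
qed

lemma smooth_lincomb:
  assumes "smooth f" "smooth g"
  shows "smooth (\<lambda>x. c * f x + d * g x)"
proof (rule smoothI[where S = "{\<lambda>x. c * f x + d * g x |f g. smooth f \<and> smooth g}"])
  fix h j assume "h \<in> {\<lambda>x. c * f x + d * g x |f g. smooth f \<and> smooth g}"
  then obtain f g where h: "h = (\<lambda>x. c * f x + d * g x)" "smooth f" "smooth g" by blast
  note diff = h(2,3)[THEN smooth_differentiable]
  show "h differentiable (at x)" for x
    unfolding h by (intro derivative_intros diff)
  have "partial_deriv j h = (\<lambda>x. c * partial_deriv j f x + d * partial_deriv j g x)"
    unfolding h by (simp add: fun_eq_iff partial_deriv_add partial_deriv_cmult diff)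
  then show "partial_deriv j h \<in> {\<lambda>x. c * f x + d * g x |f g. smooth f \<and> smooth g}"
    using h(2,3)[THEN smooth_partial_deriv]
    by (intro CollectI exI[of _ "partial_deriv j f"] exI[of _ "partial_deriv j g"]) simp
next
  show "(\<lambda>x. c * f x + d * g x) \<in> {\<lambda>x. c * f x + d * g x |f g. smooth f \<and> smooth g}"
    using assms by (intro CollectI exI[of _ f] exI[of _ g]) simp
qed

lemma smooth_zero: "smooth (\<lambda>x::real^'n::finite. 0)"
  by (rule smoothI[where S="{\<lambda>x. 0}"])
     (auto intro!: ext partial_deriv_eqI[where D="\<lambda>h. 0"])

lemma smooth_add: "smooth f \<Longrightarrow> smooth g \<Longrightarrow> smooth (\<lambda>x. f x + g x)"
  using smooth_lincomb[of f g 1 1] by simp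

lemma smooth_cmult: "smooth f \<Longrightarrow> smooth (\<lambda>x. c * f x)"
  using smooth_lincomb[of f f c 0] by simp

text \<open>The stable class consists of the functions \<open>x\<^sub>i f + g\<close>: the summand \<open>g\<close> absorbs the
  undifferentiated term of the product rule.\<close>

lemma smooth_coord_mult:
  fixes f :: "real^'n::finite \<Rightarrow> complex"
  assumes "smooth f"
  shows "smooth (\<lambda>x. complex_of_real (x $ i) * f x)"
proof (rule smoothI[where S = "{\<lambda>x. complex_of_real (x $ i) * f x + g x |f g. smooth f \<and> smooth g}"])
  show "(\<lambda>x. complex_of_real (x $ i) * f x) \<in> {\<lambda>x. complex_of_real (x $ i) * f x + g x |f g. smooth f \<and> smooth g}"
    using assms smooth_zero by (intro CollectI exI[of _ f] exI[of _ "\<lambda>x. 0"]) simp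
  fix h j assume "h \<in> {\<lambda>x. complex_of_real (x $ i) * f x + g x |f g. smooth f \<and> smooth g}"
  then obtain f g where h: "h = (\<lambda>x. complex_of_real (x $ i) * f x + g x)" "smooth f" "smooth g" by blast
  note diff = h(2,3)[THEN smooth_differentiable]
  have d1: "(\<lambda>x. complex_of_real (x $ i) * f x) differentiable (at x)" for x
    using has_derivative_coord_mult diff(1) unfolding differentiable_def by blast
  show "h differentiable (at x)" for x
    unfolding h by (intro derivative_intros diff d1)
  have "partial_deriv j h = (\<lambda>x. complex_of_real (x $ i) * partial_deriv j f x
      + (of_bool (i = j) * f x + partial_deriv j g x))"
    unfolding h by (simp add: fun_eq_iff partial_deriv_add partial_deriv_coord_mult diff d1)
  moreover have "smooth (\<lambda>x. of_bool (i = j) * f x + partial_deriv j g x)"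
    by (intro smooth_add smooth_cmult smooth_partial_deriv h)
  ultimately show "partial_deriv j h \<in> {\<lambda>x. complex_of_real (x $ i) * f x + g x |f g. smooth f \<and> smooth g}"
    using h(2)[THEN smooth_partial_deriv]
    by (intro CollectI exI[of _ "partial_deriv j f"]
        exI[of _ "\<lambda>x. of_bool (i = j) * f x + partial_deriv j g x"]) simp
qed

lemma test_functions_UNIV_iff:
  fixes f :: "real^'n::finite \<Rightarrow> complex"
  shows "f \<in> test_functions UNIV \<longleftrightarrow> smooth f \<and> (\<exists>R. \<forall>x. R < norm x \<longrightarrow> f x = 0)"
proof -
  have "compact (closure {x. f x \<noteq> 0}) \<longleftrightarrow> (\<exists>R. \<forall>x. R < norm x \<longrightarrow> f x = 0)"
    unfolding compact_closure bounded_iff by (auto simp: not_less[symmetric])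
  then show ?thesis by (auto simp: test_functions_def)
qed

lemma test_functions_mono: "U \<subseteq> V \<Longrightarrow> test_functions U \<subseteq> test_functions V"
  by (auto simp: test_functions_def)

lemma test_functions_smooth: "f \<in> test_functions U \<Longrightarrow> smooth f"
  by (auto simp: test_functions_def)

lemma test_functions_cmult:
  fixes f :: "real^'n::finite \<Rightarrow> complex"
  shows "f \<in> test_functions UNIV \<Longrightarrow> (\<lambda>x. c * f x) \<in> test_functions UNIV"
  unfolding test_functions_UNIV_iff using smooth_cmult by fastforce

lemma test_functions_coord_mult:
  fixes f :: "real^'n::finite \<Rightarrow> complex"
  shows "f \<in> test_functions UNIV \<Longrightarrow> (\<lambda>x. complex_of_real (x $ i) * f x) \<in> test_functions UNIV"
  unfolding test_functions_UNIV_iff using smooth_coord_mult by fastforce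

lemma partial_deriv_vanishing:
  fixes f :: "real^'n::finite \<Rightarrow> complex"
  assumes R: "\<And>x. R < norm x \<Longrightarrow> f x = 0" and x: "R < norm x"
  shows "partial_deriv j f x = 0"
proof -
  have "((\<lambda>x. 0) has_derivative (\<lambda>h. 0)) (at x)" by simp
  moreover have "open {x::real^'n. R < norm x}"
    by (intro open_Collect_less continuous_intros)
  ultimately have "(f has_derivative (\<lambda>h. 0)) (at x)"
    by (rule has_derivative_transform_within_open) (use x R in auto)
  then show ?thesis by (rule partial_deriv_eqI)
qed

lemma test_functions_partial_deriv:
  fixes f :: "real^'n::finite \<Rightarrow> complex"
  assumes "f \<in> test_functions UNIV"
  shows "partial_deriv j f \<in> test_functions UNIV"
proof -
  from assms obtain R where R: "\<And>x. R < norm x \<Longrightarrow> f x = 0" and "smooth f"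
    unfolding test_functions_UNIV_iff by blast
  have "partial_deriv j f x = 0" if "R < norm x" for x
    using R that by (rule partial_deriv_vanishing)
  with \<open>smooth f\<close> show ?thesis
    unfolding test_functions_UNIV_iff using smooth_partial_deriv by blast
qed

lemma continuous_vanishing_integrable:
  fixes f :: "real^'n::finite \<Rightarrow> complex"
  assumes "continuous_on S f" "compact S" "\<And>x. x \<notin> S \<Longrightarrow> f x = 0"
  shows "integrable lborel f"
proof -
  have "integrable lborel (\<lambda>x. indicator S x *\<^sub>R f x)"
    by (rule borel_integrable_compact[OF assms(2,1)])
  also have "(\<lambda>x. indicator S x *\<^sub>R f x) = f"
    using assms(3) by (auto simp: indicator_def)
  finally show ?thesis .
qed

lemma test_functions_integrable:
  fixes f :: "real^'n::finite \<Rightarrow> complex"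
  assumes "f \<in> test_functions UNIV"
  shows "integrable lborel f"
proof -
  from assms obtain R where R: "\<And>x. R < norm x \<Longrightarrow> f x = 0" and "smooth f"
    unfolding test_functions_UNIV_iff by blast
  show ?thesis
    by (rule continuous_vanishing_integrable[of "cball 0 R"])
       (use R smooth_continuous_on[OF \<open>smooth f\<close>] in auto)
qed

lemma test_functions_bounded:
  fixes f :: "real^'n::finite \<Rightarrow> complex"
  assumes "f \<in> test_functions UNIV"
  obtains B where "B > 0" "\<And>x. norm (f x) \<le> B"
proof -
  from assms obtain R where R: "\<And>x. R < norm x \<Longrightarrow> f x = 0" and "smooth f"
    unfolding test_functions_UNIV_iff by blast
  have "bounded (f ` cball 0 R)"
    by (intro compact_imp_bounded compact_continuous_image smooth_continuous_on \<open>smooth f\<close>) simp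
  then obtain B where B: "B > 0" "\<And>x. norm x \<le> R \<Longrightarrow> norm (f x) \<le> B"
    unfolding bounded_pos by (metis imageI mem_cball_0)
  have "norm (f x) \<le> B" for x
    using B R[of x] by (cases "norm x \<le> R") auto
  with B(1) that show thesis by blast
qed

text \<open>By translation invariance every difference quotient of \<open>f\<close> in direction \<open>j\<close> has integral zero.
  The quotients converge to the derivative and, by the mean value inequality, are dominated by a
  multiple of the indicator of a ball.\<close>

lemma integral_partial_deriv_eq_0:
  fixes f :: "real^'n::finite \<Rightarrow> complex"
  assumes diff: "\<And>x. f differentiable (at x)"
    and cont: "continuous_on UNIV (partial_deriv j f)"
    and R: "\<And>x. R < norm x \<Longrightarrow> f x = 0"
  shows "(LINT x|lborel. partial_deriv j f x) = 0"
proof -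
  have "bounded (partial_deriv j f ` cball 0 R)"
    by (intro compact_imp_bounded compact_continuous_image continuous_on_subset[OF cont]) auto
  then obtain B where B: "B > 0" "\<And>x. norm x \<le> R \<Longrightarrow> norm (partial_deriv j f x) \<le> B"
    unfolding bounded_pos by (metis imageI mem_cball_0)
  have "norm (partial_deriv j f x) \<le> B" for x
    using B partial_deriv_vanishing[of R f x j, OF R] by (cases "norm x \<le> R") (auto simp: not_le)
  note B = B(1) this
  have dline: "((\<lambda>s. f (x + s *\<^sub>R axis j 1)) has_vector_derivative partial_deriv j f (x + s *\<^sub>R axis j 1)) (at s)" for x :: "real^'n" and s
  proof -
    obtain D where D: "(f has_derivative D) (at (x + s *\<^sub>R axis j 1))"
       "partial_deriv j f (x + s *\<^sub>R axis j 1) = D (axis j 1)"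
      using has_derivative_partial_deriv[OF diff] by blast
    have "((\<lambda>s. f (x + s *\<^sub>R axis j 1)) has_derivative (\<lambda>h. D (h *\<^sub>R axis j 1))) (at s)"
      by (rule has_derivative_compose[where g = f and f = "\<lambda>s. x + s *\<^sub>R axis j 1", OF _ D(1)]) (auto intro!: derivative_eq_intros)
    moreover have "D (h *\<^sub>R axis j 1) = h *\<^sub>R partial_deriv j f (x + s *\<^sub>R axis j 1)" for h
      using D by (simp add: linear_scale has_derivative_linear)
    ultimately show ?thesis by (simp add: has_vector_derivative_def)
  qed
  let ?q = "\<lambda>n::nat. \<lambda>x. (f (x + (1 / Suc n) *\<^sub>R axis j 1) - f x) /\<^sub>R (1 / Suc n)"
  have int: "integrable lborel f"
    by (rule continuous_vanishing_integrable[of "cball 0 R"])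
       (use R diff in \<open>auto intro!: continuous_at_imp_continuous_on differentiable_imp_continuous_within\<close>)
  have [measurable]: "f \<in> borel_measurable borel" using int by simp
  have int': "integrable lborel (\<lambda>x. f (x + v))"
    and intv: "(LINT x|lborel. f (x + v)) = (LINT x|lborel. f x)" for v
  proof -
    have *: "f \<circ> (\<lambda>x. v + x) = (\<lambda>x. f (x + v))" by (auto simp: add.commute)
    have "integrable (distr lborel borel ((+) v)) f"
      using int by (simp add: lborel_distr_plus)
    then show "integrable lborel (\<lambda>x. f (x + v))"
      by (simp add: integrable_distr_eq add.commute)
    have "(LINT x|lborel. f x) = (LINT x|distr lborel borel ((+) v). f x)"
      by (simp add: lborel_distr_plus)
    also have "\<dots> = (LINT x|lborel. f (x + v))"
      by (simp add: integral_distr add.commute)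
    finally show "(LINT x|lborel. f (x + v)) = (LINT x|lborel. f x)" ..
  qed
  have q0: "(LINT x|lborel. ?q n x) = 0" for n
    by (simp add: Bochner_Integration.integral_diff[OF int' int] intv)
  have "(\<lambda>n. LINT x|lborel. ?q n x) \<longlonglongrightarrow> (LINT x|lborel. partial_deriv j f x)"
  proof (rule integral_dominated_convergence[where w = "\<lambda>x. indicator (cball 0 (R + 1)) x *\<^sub>R B"])
    show "partial_deriv j f \<in> borel_measurable lborel"
      using borel_measurable_continuous_onI[OF cont] by simp
    show "?q n \<in> borel_measurable lborel" for n
      using int int' by (intro borel_measurable_scaleR borel_measurable_diff) auto
    show "integrable lborel (\<lambda>x::real^'n. indicator (cball 0 (R + 1)) x *\<^sub>R B)"
      by (rule borel_integrable_compact) auto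
    show "AE x in lborel. (\<lambda>n. ?q n x) \<longlonglongrightarrow> partial_deriv j f x"
    proof (rule AE_I2)
      fix x
      have "((\<lambda>h. (f (x + h *\<^sub>R axis j 1) - f x) /\<^sub>R h) \<longlongrightarrow> partial_deriv j f x) (at 0)"
      proof -
        have "((\<lambda>h. norm (f (x + h *\<^sub>R axis j 1) - f x - h *\<^sub>R partial_deriv j f x) / norm h) \<longlongrightarrow> 0) (at 0)"
          using dline[of x 0] by (simp add: has_vector_derivative_def has_derivative_at)
        moreover have "norm (f (x + h *\<^sub>R axis j 1) - f x - h *\<^sub>R partial_deriv j f x) / norm h
            = norm ((f (x + h *\<^sub>R axis j 1) - f x) /\<^sub>R h - partial_deriv j f x)" if "h \<noteq> 0" for h
        proof -
          have "f (x + h *\<^sub>R axis j 1) - f x - h *\<^sub>R partial_deriv j f x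
             = h *\<^sub>R ((f (x + h *\<^sub>R axis j 1) - f x) /\<^sub>R h - partial_deriv j f x)"
            using that by (simp add: algebra_simps)
          then show ?thesis using that by simp
        qed
        then have "\<forall>\<^sub>F h in at 0. norm (f (x + h *\<^sub>R axis j 1) - f x - h *\<^sub>R partial_deriv j f x) / norm h
            = norm ((f (x + h *\<^sub>R axis j 1) - f x) /\<^sub>R h - partial_deriv j f x)"
          unfolding eventually_at_filter by (intro always_eventually) blast
        note tendsto_cong[OF this]
        ultimately have "((\<lambda>h. norm ((f (x + h *\<^sub>R axis j 1) - f x) /\<^sub>R h - partial_deriv j f x)) \<longlongrightarrow> 0) (at 0)"
          by (rule iffD1[rotated])
        then show ?thesis by (rule LIM_zero_cancel[OF tendsto_norm_zero_cancel])
      qed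
      moreover have "filterlim (\<lambda>n. 1 / real (Suc n)) (at 0) sequentially"
        using LIMSEQ_inverse_real_of_nat by (auto simp: filterlim_at field_simps)
      ultimately show "(\<lambda>n. ?q n x) \<longlonglongrightarrow> partial_deriv j f x"
        by (rule filterlim_compose)
    qed
    show "AE x in lborel. norm (?q n x) \<le> indicator (cball 0 (R + 1)) x *\<^sub>R B" for n
    proof (rule AE_I2)
      fix x
      show "norm (?q n x) \<le> indicator (cball 0 (R + 1)) x *\<^sub>R B"
      proof (cases "norm x \<le> R + 1")
        case True
        have "norm (f (x + (1 / Suc n) *\<^sub>R axis j 1) - f (x + 0 *\<^sub>R axis j 1)) \<le> B * norm (1 / Suc n - 0 :: real)"
        proof (rule differentiable_bound[of UNIV _ "\<lambda>s h. h *\<^sub>R partial_deriv j f (x + s *\<^sub>R axis j 1)"])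
          show "onorm (\<lambda>h::real. h *\<^sub>R partial_deriv j f (x + s *\<^sub>R axis j 1)) \<le> B" for s
            by (rule onorm_le) (use B(2) in \<open>simp add: mult.commute[of B] mult_left_mono\<close>)
        qed (use dline in \<open>auto simp: has_vector_derivative_def\<close>)
        then have "real (Suc n) * norm (f (x + (1 / Suc n) *\<^sub>R axis j 1) - f x) \<le> B"
          by (simp add: field_simps del: of_nat_Suc)
        then show ?thesis unfolding norm_scaleR using True by simp
      next
        case False
        have "norm x \<le> norm (x + (1 / Suc n) *\<^sub>R axis j 1) + norm ((1 / Suc n) *\<^sub>R axis j (1::real))"
          by (metis add_diff_cancel_right' norm_triangle_ineq4)
        also have "norm ((1 / Suc n) *\<^sub>R axis j (1::real)) \<le> 1" by (simp add: field_simps)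
        finally have "R < norm (x + (1 / Suc n) *\<^sub>R axis j 1)" using False by linarith
        then show ?thesis using False R by auto
      qed
    qed
  qed
  then show ?thesis unfolding q0 by (simp add: LIMSEQ_const_iff)
qed


section \<open>Product integrals and the Fourier transform of a Gaussian\<close>

lemma Basis_vec_eq: "(Basis :: (real^'n::finite) set) = range (\<lambda>j. axis j 1)"
  by (auto simp: Basis_vec_def)

text \<open>Lebesgue measure on \<open>real^'n\<close> is the image of a product of one-dimensional measures, so functions
  with separated variables are integrated one coordinate at a time.\<close>

lemma
  fixes f :: "'n::finite \<Rightarrow> real \<Rightarrow> complex"
  assumes f: "\<And>j. integrable lborel (f j)"
  shows integrable_prod_coords: "integrable lborel (\<lambda>x::real^'n. \<Prod>j\<in>UNIV. f j (x $ j))"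
    and integral_prod_coords:
      "(LINT x|lborel. (\<Prod>j\<in>UNIV. f j ((x::real^'n) $ j))) = (\<Prod>j\<in>UNIV. (LINT s|lborel. f j s))"
proof -
  interpret product_sigma_finite "\<lambda>_::real^'n. lborel :: real measure" by standard
  define ix :: "real^'n \<Rightarrow> 'n" where "ix = inv (\<lambda>j. axis j 1)"
  have inj: "inj (\<lambda>j::'n. axis j (1::real))" by (auto simp: inj_def axis_eq_axis)
  have ix: "ix (axis j 1) = j" for j
    unfolding ix_def by (rule inv_f_f[OF inj])
  let ?P = "\<Pi>\<^sub>M b\<in>(Basis :: (real^'n) set). (lborel :: real measure)"
  let ?s = "\<lambda>F. \<Sum>b\<in>(Basis :: (real^'n) set). F b *\<^sub>R b"
  let ?g = "\<lambda>x::real^'n. \<Prod>j\<in>UNIV. f j (x $ j)"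
  have nth: "?s F $ j = F (axis j 1)" for F j
    unfolding Basis_vec_eq sum.reindex[OF inj] o_def sum_component vector_scaleR_component
    by (simp add: axis_def if_distrib cong: if_cong)
  have g: "?g (?s F) = (\<Prod>b\<in>Basis. f (ix b) (F b))" for F
    unfolding nth by (simp add: Basis_vec_eq prod.reindex[OF inj] ix)
  have [measurable]: "f j \<in> borel_measurable borel" for j using f[of j] by simp
  have m: "?s \<in> measurable ?P borel" by measurable
  have mg: "?g \<in> borel_measurable borel" by measurable
  have "integrable ?P (\<lambda>F. ?g (?s F))"
    unfolding g by (rule product_integrable_prod) (auto simp: f)
  then have "integrable (distr ?P borel ?s) ?g"
    by (subst integrable_distr_eq[OF m mg])
  then show "integrable lborel ?g" by (simp flip: lborel_eq)
  have "(LINT x|lborel. ?g x) = (LINT x|distr ?P borel ?s. ?g x)"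
    by (simp flip: lborel_eq)
  also have "\<dots> = (LINT F|?P. ?g (?s F))"
    by (rule integral_distr[OF m mg])
  also have "\<dots> = (\<Prod>b\<in>Basis. (LINT s|lborel. f (ix b) s))"
    unfolding g by (rule product_integral_prod) (auto simp: f)
  also have "\<dots> = (\<Prod>j\<in>UNIV. (LINT s|lborel. f j s))"
    by (simp add: Basis_vec_eq prod.reindex[OF inj] ix)
  finally show "(LINT x|lborel. ?g x) = (\<Prod>j\<in>UNIV. (LINT s|lborel. f j s))" .
qed

lemma integrable_tensor:
  fixes f :: "'a::euclidean_space \<Rightarrow> complex" and g :: "'b::euclidean_space \<Rightarrow> complex"
  assumes f: "integrable lborel f" and g: "integrable lborel g"
  shows "integrable (lborel \<Otimes>\<^sub>M lborel) (\<lambda>(x, y). f x * g y)"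
proof (rule lborel_pair.Fubini_integrable)
  have [measurable]: "f \<in> borel_measurable borel" "g \<in> borel_measurable borel"
    using f g by simp_all
  show "(\<lambda>(x, y). f x * g y) \<in> borel_measurable (lborel \<Otimes>\<^sub>M lborel)" by measurable
  show "integrable lborel (\<lambda>x. LINT y|lborel. norm (case (x, y) of (x, y) \<Rightarrow> f x * g y))"
    using integrable_norm[OF f] by (simp add: norm_mult)
  show "AE x in lborel. integrable lborel (\<lambda>y. case (x, y) of (x, y) \<Rightarrow> f x * g y)"
    using g by simp
qed

lemma norm_sq_vec: "(norm (x::real^'n::finite))\<^sup>2 = (\<Sum>j\<in>UNIV. (x $ j)\<^sup>2)"
  by (simp add: norm_vec_def L2_set_def sum_nonneg)

lemma exp_inner_vec:
  "exp (\<i> * complex_of_real (x \<bullet> y)) = (\<Prod>j\<in>UNIV. exp (\<i> * complex_of_real (x $ j * y $ j)))"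
  for x y :: "real^'n::finite"
  by (simp add: inner_vec_def sum_distrib_left exp_sum)

lemma norm_exp_i [simp]: "norm (exp (\<i> * complex_of_real r)) = 1"
  by (simp_all add: norm_exp_eq_Re)

text \<open>For \<open>\<delta> = 1\<close> this is the characteristic function of the standard normal distribution; the general
  case follows by scaling.\<close>

lemma gaussian_fourier_1d:
  assumes "\<delta> > 0"
  shows "integrable lborel (\<lambda>s. complex_of_real (exp (- (\<delta> * s)\<^sup>2 / 2)) * exp (\<i> * complex_of_real (s * y)))"
    and "(LINT s|lborel. complex_of_real (exp (- (\<delta> * s)\<^sup>2 / 2)) * exp (\<i> * complex_of_real (s * y)))
      = complex_of_real (sqrt (2 * pi) / \<delta> * exp (- (y / \<delta>)\<^sup>2 / 2))"
proof -
  let ?g = "\<lambda>y s. complex_of_real (exp (- s\<^sup>2 / 2)) * exp (\<i> * complex_of_real (s * y))"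
  have int0: "integrable lborel (\<lambda>s::real. exp (- s\<^sup>2 / 2))"
  proof -
    have "integrable lborel (\<lambda>s. sqrt (2 * pi) * (std_normal_density s * s ^ 0))"
      by (rule integrable_mult_right) (rule integrable_std_normal_moment)
    then show ?thesis by (simp add: std_normal_density_def)
  qed
  have int1: "integrable lborel (?g y)" for y
    by (rule Bochner_Integration.integrable_bound[OF int0]) (auto simp: norm_mult)
  have val: "(LINT s|lborel. ?g y s) = complex_of_real (sqrt (2 * pi) * exp (- y\<^sup>2 / 2))" for y
  proof -
    have "complex_of_real (exp (- y\<^sup>2 / 2)) = char std_normal_distribution y"
      by (simp add: char_std_normal_distribution)
    also have "\<dots> = (LINT s|lborel. std_normal_density s *\<^sub>R iexp (y * s))"
      unfolding char_def by (subst integral_density) auto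
    also have "\<dots> = (LINT s|lborel. complex_of_real (1 / sqrt (2 * pi)) * ?g y s)"
      by (intro Bochner_Integration.integral_cong) (auto simp: std_normal_density_def scaleR_conv_of_real mult_ac)
    also have "\<dots> = complex_of_real (1 / sqrt (2 * pi)) * (LINT s|lborel. ?g y s)"
      by simp
    finally show ?thesis by (simp add: field_simps)
  qed
  let ?h = "\<lambda>s. complex_of_real (exp (- (\<delta> * s)\<^sup>2 / 2)) * exp (\<i> * complex_of_real (s * y))"
  have h: "?h s = ?g (y / \<delta>) (0 + \<delta> * s)" for s using assms by (simp add: field_simps)
  have "integrable lborel (\<lambda>s. ?g (y / \<delta>) (0 + \<delta> * s))"
    by (rule lborel_integrable_real_affine[OF int1]) (use assms in simp)
  then show "integrable lborel ?h" by (simp only: h)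
  have "complex_of_real (sqrt (2 * pi) * exp (- (y / \<delta>)\<^sup>2 / 2)) = (LINT s|lborel. ?g (y / \<delta>) s)"
    by (rule val[symmetric])
  also have "\<dots> = \<bar>\<delta>\<bar> *\<^sub>R (LINT s|lborel. ?g (y / \<delta>) (0 + \<delta> * s))"
    by (rule lborel_integral_real_affine[of \<delta> "?g (y / \<delta>)" 0]) (use assms in simp)
  also have "\<dots> = \<bar>\<delta>\<bar> *\<^sub>R (LINT s|lborel. ?h s)"
    by (simp only: h)
  finally have "complex_of_real (sqrt (2 * pi) * exp (- (y / \<delta>)\<^sup>2 / 2)) = \<bar>\<delta>\<bar> *\<^sub>R (LINT s|lborel. ?h s)" .
  then show "(LINT s|lborel. ?h s) = complex_of_real (sqrt (2 * pi) / \<delta> * exp (- (y / \<delta>)\<^sup>2 / 2))"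
    using assms by (simp add: scaleR_conv_of_real field_simps)
qed

lemma gaussian_fourier:
  fixes w :: "real^'n::finite"
  assumes "\<delta> > 0"
  shows "integrable lborel (\<lambda>\<xi>::real^'n. complex_of_real (exp (- (\<delta> * norm \<xi>)\<^sup>2 / 2)) * exp (\<i> * complex_of_real (\<xi> \<bullet> w)))"
    and "(LINT \<xi>|lborel. complex_of_real (exp (- (\<delta> * norm \<xi>)\<^sup>2 / 2)) * exp (\<i> * complex_of_real (\<xi> \<bullet> w)))
      = complex_of_real ((sqrt (2 * pi) / \<delta>) ^ CARD('n) * exp (- (norm w / \<delta>)\<^sup>2 / 2))"
proof -
  let ?f = "\<lambda>j s. complex_of_real (exp (- (\<delta> * s)\<^sup>2 / 2)) * exp (\<i> * complex_of_real (s * w $ j))"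
  have expn: "exp (- (c * norm \<xi>)\<^sup>2 / 2) = (\<Prod>j\<in>UNIV. exp (- (c * \<xi> $ j)\<^sup>2 / 2))" for c and \<xi> :: "real^'n"
    by (simp add: power_mult_distrib norm_sq_vec flip: exp_sum)
       (simp add: sum_distrib_left sum_negf sum_divide_distrib)
  have eq: "complex_of_real (exp (- (\<delta> * norm \<xi>)\<^sup>2 / 2)) * exp (\<i> * complex_of_real (\<xi> \<bullet> w))
      = (\<Prod>j\<in>UNIV. ?f j (\<xi> $ j))" for \<xi>
    unfolding expn exp_inner_vec by (simp add: prod.distrib)
  show "integrable lborel (\<lambda>\<xi>::real^'n. complex_of_real (exp (- (\<delta> * norm \<xi>)\<^sup>2 / 2)) * exp (\<i> * complex_of_real (\<xi> \<bullet> w)))"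
    unfolding eq by (rule integrable_prod_coords) (rule gaussian_fourier_1d[OF assms])
  have "(LINT \<xi>|lborel. complex_of_real (exp (- (\<delta> * norm \<xi>)\<^sup>2 / 2)) * exp (\<i> * complex_of_real (\<xi> \<bullet> w)))
     = (\<Prod>j\<in>UNIV. (LINT s|lborel. ?f j s))"
    unfolding eq by (rule integral_prod_coords) (rule gaussian_fourier_1d[OF assms])
  also have "\<dots> = complex_of_real ((sqrt (2 * pi) / \<delta>) ^ CARD('n) * exp (- (norm w / \<delta>)\<^sup>2 / 2))"
    unfolding gaussian_fourier_1d(2)[OF assms] of_real_prod[symmetric] prod.distrib
    using expn[of "1 / \<delta>" w] by simp
  finally show "(LINT \<xi>|lborel. complex_of_real (exp (- (\<delta> * norm \<xi>)\<^sup>2 / 2)) * exp (\<i> * complex_of_real (\<xi> \<bullet> w)))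
      = complex_of_real ((sqrt (2 * pi) / \<delta>) ^ CARD('n) * exp (- (norm w / \<delta>)\<^sup>2 / 2))" .
qed

section \<open>The inverse Fourier transform of a test function\<close>

text \<open>Up to the factor \<open>(2 \<pi>) ^ N\<close> this is the inverse Fourier transform.\<close>

definition cofourier :: "(real^'n::finite \<Rightarrow> complex) \<Rightarrow> real^'n \<Rightarrow> complex" where
  "cofourier g \<xi> = (LINT x|lborel. g x * exp (\<i> * complex_of_real (x \<bullet> \<xi>)))"

lemma cofourier_integrable:
  assumes "integrable lborel g"
  shows "integrable lborel (\<lambda>x. g x * exp (\<i> * complex_of_real (x \<bullet> \<xi>)))"
proof -
  have [measurable]: "g \<in> borel_measurable borel" using assms by simp
  show ?thesis
    by (rule Bochner_Integration.integrable_bound[OF assms]) (auto simp: norm_mult)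
qed

lemma cofourier_cmult: "cofourier (\<lambda>x. c * g x) \<xi> = c * cofourier g \<xi>"
  by (simp add: cofourier_def mult.assoc)

lemma norm_cofourier_le: "norm (cofourier g \<xi>) \<le> (LINT x|lborel. norm (g x))"
  unfolding cofourier_def by (rule order_trans[OF integral_norm_bound]) (simp add: norm_mult)

text \<open>The remainder of the first-order expansion of the exponential is quadratic,
  uniformly on the support of \<open>g\<close>, so that one may differentiate under the integral.\<close>

lemma cofourier_has_derivative:
  fixes g :: "real^'n::finite \<Rightarrow> complex"
  assumes g: "g \<in> test_functions UNIV"
  shows "(cofourier g has_derivative
     (\<lambda>h. \<Sum>j\<in>UNIV. complex_of_real (h $ j) * cofourier (\<lambda>x. \<i> * (complex_of_real (x $ j) * g x)) \<xi>)) (at \<xi>)"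
    (is "(_ has_derivative ?D) _")
proof -
  from g obtain R0 where R0: "\<And>x. R0 < norm x \<Longrightarrow> g x = 0"
    unfolding test_functions_UNIV_iff by blast
  define R where "R = max R0 0"
  have R: "norm x \<le> R" if "g x \<noteq> 0" for x using R0[of x] that unfolding R_def by fastforce
  have intg: "integrable lborel g" by (rule test_functions_integrable[OF g])
  define C where "C = R\<^sup>2 * (LINT x|lborel. norm (g x))"
  have intj: "integrable lborel (\<lambda>x. \<i> * (complex_of_real (x $ j) * g x))" for j
    by (intro test_functions_integrable test_functions_cmult test_functions_coord_mult g)
  have [measurable]: "g \<in> borel_measurable borel" using intg by simp
  have bound: "norm (cofourier g (\<xi> + h) - cofourier g \<xi> - ?D h) \<le> C * (norm h)\<^sup>2" for h
  proof -
    let ?r = "\<lambda>x. g x * exp (\<i> * complex_of_real (x \<bullet> \<xi>)) * (iexp (x \<bullet> h) - 1 - \<i> * complex_of_real (x \<bullet> h))"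
    have "?D h = (LINT x|lborel. (\<Sum>j\<in>UNIV. complex_of_real (h $ j) *
        (\<i> * (complex_of_real (x $ j) * g x) * exp (\<i> * complex_of_real (x \<bullet> \<xi>)))))"
      unfolding cofourier_def
      by (subst Bochner_Integration.integral_sum) (auto intro!: cofourier_integrable intj)
    also have "\<dots> = (LINT x|lborel. \<i> * complex_of_real (x \<bullet> h) * (g x * exp (\<i> * complex_of_real (x \<bullet> \<xi>))))"
      by (rule Bochner_Integration.integral_cong) (auto simp: inner_vec_def sum_distrib_left sum_distrib_right mult_ac)
    finally have D: "?D h = (LINT x|lborel. \<i> * complex_of_real (x \<bullet> h) * (g x * exp (\<i> * complex_of_real (x \<bullet> \<xi>))))" .
    have intD: "integrable lborel (\<lambda>x. \<i> * complex_of_real (x \<bullet> h) * (g x * exp (\<i> * complex_of_real (x \<bullet> \<xi>))))"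
    proof (rule Bochner_Integration.integrable_bound)
      show "integrable lborel (\<lambda>x. complex_of_real (R * norm h) * g x)" using intg by simp
      show "AE x in lborel. norm (\<i> * complex_of_real (x \<bullet> h) * (g x * exp (\<i> * complex_of_real (x \<bullet> \<xi>))))
         \<le> norm (complex_of_real (R * norm h) * g x)"
      proof (rule AE_I2)
        fix x
        have "\<bar>x \<bullet> h\<bar> * norm (g x) \<le> (R * norm h) * norm (g x)"
        proof (cases "g x = 0")
          case False
          then have "\<bar>x \<bullet> h\<bar> \<le> R * norm h"
            by (meson Cauchy_Schwarz_ineq2 R mult_right_mono norm_ge_zero order_trans)
          then show ?thesis by (rule mult_right_mono) simp
        qed simp
        moreover have "R \<ge> 0" by (simp add: R_def)
        ultimately show "norm (\<i> * complex_of_real (x \<bullet> h) * (g x * exp (\<i> * complex_of_real (x \<bullet> \<xi>))))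
         \<le> norm (complex_of_real (R * norm h) * g x)"
          by (simp add: norm_mult)
      qed
    qed measurable
    have "cofourier g (\<xi> + h) - cofourier g \<xi> - ?D h = (LINT x|lborel. g x * exp (\<i> * complex_of_real (x \<bullet> (\<xi> + h)))
        - g x * exp (\<i> * complex_of_real (x \<bullet> \<xi>)) - \<i> * complex_of_real (x \<bullet> h) * (g x * exp (\<i> * complex_of_real (x \<bullet> \<xi>))))"
      unfolding D unfolding cofourier_def
      by (simp add: Bochner_Integration.integral_diff cofourier_integrable[OF intg] intD
          Bochner_Integration.integrable_diff)
    also have "\<dots> = (LINT x|lborel. ?r x)"
      by (rule Bochner_Integration.integral_cong) (auto simp: inner_add_right exp_add algebra_simps)
    finally have diff_eq: "cofourier g (\<xi> + h) - cofourier g \<xi> - ?D h = (LINT x|lborel. ?r x)" .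
    have "norm (cofourier g (\<xi> + h) - cofourier g \<xi> - ?D h) \<le> (LINT x|lborel. norm (?r x))"
      unfolding diff_eq by (rule integral_norm_bound)
    also have "\<dots> \<le> (LINT x|lborel. (R * norm h)\<^sup>2 * norm (g x))"
    proof (rule integral_mono')
      show "integrable lborel (\<lambda>x. (R * norm h)\<^sup>2 * norm (g x))" using intg by simp
      show "norm (?r x) \<le> (R * norm h)\<^sup>2 * norm (g x)" for x
      proof (cases "g x = 0")
        case False
        have "norm (iexp (x \<bullet> h) - 1 - \<i> * complex_of_real (x \<bullet> h)) \<le> \<bar>x \<bullet> h\<bar>\<^sup>2 / 2"
          using iexp_approx1[of "x \<bullet> h" 1] by (simp add: numeral_2_eq_2 algebra_simps)
        also have "\<dots> \<le> \<bar>x \<bullet> h\<bar>\<^sup>2" by simp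
        also have "\<bar>x \<bullet> h\<bar> \<le> R * norm h"
          by (meson Cauchy_Schwarz_ineq2 R False mult_right_mono norm_ge_zero order_trans)
        then have "\<bar>x \<bullet> h\<bar>\<^sup>2 \<le> (R * norm h)\<^sup>2" by (rule power_mono) simp
        finally show ?thesis by (simp add: norm_mult mult.commute mult_left_mono)
      qed simp
    qed simp
    also have "\<dots> = C * (norm h)\<^sup>2" by (simp add: C_def power_mult_distrib)
    finally show ?thesis .
  qed
  have "bounded_linear ?D"
    by (intro bounded_linear_sum bounded_linear_mult_left bounded_linear_compose[OF bounded_linear_of_real]
        bounded_linear_compose[OF bounded_linear_mult_left] bounded_linear_vec_nth)
  moreover have "(\<lambda>h. norm (cofourier g (\<xi> + h) - cofourier g \<xi> - ?D h) / norm h) \<midarrow>0\<rightarrow> 0"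
  proof (rule Lim_null_comparison)
    show "\<forall>\<^sub>F h in at 0. norm (norm (cofourier g (\<xi> + h) - cofourier g \<xi> - ?D h) / norm h) \<le> C * norm h"
      unfolding eventually_at_filter
      using bound by (intro always_eventually) (auto simp: divide_simps power2_eq_square mult.assoc)
    show "((\<lambda>h::real^'n. C * norm h) \<longlongrightarrow> 0) (at 0)"
      by (intro tendsto_eq_intros) auto
  qed
  ultimately show ?thesis unfolding has_derivative_at by blast
qed

lemma partial_deriv_cofourier:
  fixes g :: "real^'n::finite \<Rightarrow> complex"
  assumes "g \<in> test_functions UNIV"
  shows "partial_deriv j (cofourier g) = cofourier (\<lambda>x. \<i> * (complex_of_real (x $ j) * g x))"
  by (rule ext) (simp add: partial_deriv_eqI[OF cofourier_has_derivative[OF assms]] axis_def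
      if_distrib[of complex_of_real] if_distrib[of "\<lambda>x. x * _"] cong: if_cong)

text \<open>The image of the test functions under the transform is stable under partial derivatives,
  because the test functions are stable under multiplication by coordinates.\<close>

lemma iter_partial_cofourier:
  fixes g :: "real^'n::finite \<Rightarrow> complex"
  assumes "g \<in> test_functions UNIV"
  shows "iter_partial js (cofourier g) \<in> cofourier ` test_functions UNIV"
proof (induction js)
  case (Cons j js)
  then obtain g' where g': "g' \<in> test_functions UNIV" "iter_partial js (cofourier g) = cofourier g'" by blast
  have "iter_partial (j # js) (cofourier g) = partial_deriv j (cofourier g')"
    using g'(2) by (simp add: iter_partial_def)
  then show ?case
    using partial_deriv_cofourier[OF g'(1)] test_functions_cmult[OF test_functions_coord_mult[OF g'(1)]] by auto
qed (use assms in \<open>auto simp: iter_partial_def\<close>)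

lemma smooth_cofourier:
  fixes g :: "real^'n::finite \<Rightarrow> complex"
  assumes "g \<in> test_functions UNIV"
  shows "smooth (cofourier g)"
proof -
  have "iter_partial js (cofourier g) differentiable (at x)" for js x
  proof -
    obtain g' where "g' \<in> test_functions UNIV" "iter_partial js (cofourier g) = cofourier g'"
      using iter_partial_cofourier[OF assms] by blast
    then show ?thesis using differentiableI[OF cofourier_has_derivative] by simp
  qed
  then show ?thesis by (simp add: smooth_def)
qed

lemma exp_inner_has_derivative:
  "((\<lambda>x. exp (\<i> * complex_of_real (x \<bullet> \<xi>))) has_derivative
     (\<lambda>h. \<i> * complex_of_real (h \<bullet> \<xi>) * exp (\<i> * complex_of_real (x \<bullet> \<xi>)))) (at x)"
proof -
  have *: "(exp has_derivative (\<lambda>y. exp (\<i> * complex_of_real (x \<bullet> \<xi>)) * y)) (at (\<i> * complex_of_real (x \<bullet> \<xi>)))"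
    using DERIV_exp unfolding has_field_derivative_def .
  have "((\<lambda>x. \<i> * complex_of_real (x \<bullet> \<xi>)) has_derivative (\<lambda>h. \<i> * complex_of_real (h \<bullet> \<xi>))) (at x)"
    by (auto intro!: derivative_eq_intros)
  from has_derivative_compose[OF this *] show ?thesis by (simp add: mult.commute)
qed

text \<open>Integration by parts against the exponential.\<close>

lemma cofourier_coord_mult:
  fixes g :: "real^'n::finite \<Rightarrow> complex"
  assumes g: "g \<in> test_functions UNIV"
  shows "complex_of_real (\<xi> $ j) * cofourier g \<xi> = \<i> * cofourier (partial_deriv j g) \<xi>"
proof -
  let ?e = "\<lambda>x. exp (\<i> * complex_of_real (x \<bullet> \<xi>))"
  have sm: "smooth g" using g by (rule test_functions_smooth)
  from g obtain R where R: "\<And>x. R < norm x \<Longrightarrow> g x = 0"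
    unfolding test_functions_UNIV_iff by blast
  have der: "((\<lambda>x. g x * ?e x) has_derivative
       (\<lambda>h. g x * (\<i> * complex_of_real (h \<bullet> \<xi>) * ?e x) + frechet_derivative g (at x) h * ?e x)) (at x)" for x
    by (intro has_derivative_mult exp_inner_has_derivative)
       (use smooth_differentiable[OF sm] frechet_derivative_works in blast)
  have pd: "partial_deriv j (\<lambda>x. g x * ?e x)
      = (\<lambda>x. \<i> * complex_of_real (\<xi> $ j) * (g x * ?e x) + partial_deriv j g x * ?e x)"
    by (rule ext) (simp add: partial_deriv_eqI[OF der] inner_axis' partial_deriv_def[of j g])
  have "0 = (LINT x|lborel. partial_deriv j (\<lambda>x. g x * ?e x) x)"
  proof (rule integral_partial_deriv_eq_0[symmetric])
    show "(\<lambda>x. g x * ?e x) differentiable at x" for x using der differentiable_def by blast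
    show "continuous_on UNIV (partial_deriv j (\<lambda>x. g x * ?e x))"
      unfolding pd by (intro continuous_intros smooth_continuous_on sm smooth_partial_deriv)
  qed (use R in auto)
  also have "\<dots> = \<i> * complex_of_real (\<xi> $ j) * cofourier g \<xi> + cofourier (partial_deriv j g) \<xi>"
    unfolding pd cofourier_def
    by (subst Bochner_Integration.integral_add)
       (auto intro!: integrable_mult_right cofourier_integrable[OF test_functions_integrable]
         test_functions_partial_deriv g simp: mult.assoc)
  finally have "\<i> * complex_of_real (\<xi> $ j) * cofourier g \<xi> = - cofourier (partial_deriv j g) \<xi>"
    by (simp add: eq_neg_iff_add_eq_0)
  then have "\<i> * (\<i> * complex_of_real (\<xi> $ j) * cofourier g \<xi>) = \<i> * (- cofourier (partial_deriv j g) \<xi>)" by simp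
  then show ?thesis by (simp add: mult.assoc[symmetric])
qed

text \<open>Since \<open>1 + norm \<xi>\<close> is at most one plus the sum of the \<open>\<bar>\<xi>\<^sub>j\<bar>\<close>, each further power of the weight is paid
  for by one integration by parts.\<close>

lemma cofourier_rapid_decay:
  fixes g :: "real^'n::finite \<Rightarrow> complex"
  assumes "g \<in> test_functions UNIV"
  shows "\<exists>C. \<forall>\<xi>. (1 + norm \<xi>) ^ m * norm (cofourier g \<xi>) \<le> C"
  using assms
proof (induction m arbitrary: g)
  case 0
  then show ?case using norm_cofourier_le by auto
next
  case (Suc m)
  obtain C0 where C0: "\<And>\<xi>. (1 + norm \<xi>) ^ m * norm (cofourier g \<xi>) \<le> C0"
    using Suc by blast
  have "\<exists>C. \<forall>\<xi>. (1 + norm \<xi>) ^ m * norm (cofourier (partial_deriv j g) \<xi>) \<le> C" for j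
    by (rule Suc.IH) (rule test_functions_partial_deriv[OF Suc.prems])
  then obtain C where C: "\<And>j \<xi>. (1 + norm \<xi>) ^ m * norm (cofourier (partial_deriv j g) \<xi>) \<le> C j" by metis
  have "(1 + norm \<xi>) ^ Suc m * norm (cofourier g \<xi>) \<le> C0 + (\<Sum>j\<in>UNIV. C j)" for \<xi>
  proof -
    have "(1 + norm \<xi>) ^ Suc m * norm (cofourier g \<xi>) = (1 + norm \<xi>) * ((1 + norm \<xi>) ^ m * norm (cofourier g \<xi>))" by simp
    also have "\<dots> \<le> (1 + (\<Sum>j\<in>UNIV. \<bar>\<xi> $ j\<bar>)) * ((1 + norm \<xi>) ^ m * norm (cofourier g \<xi>))"
      by (intro mult_right_mono add_left_mono norm_le_l1_cart) auto
    also have "\<dots> = (1 + norm \<xi>) ^ m * norm (cofourier g \<xi>) + (\<Sum>j\<in>UNIV. (1 + norm \<xi>) ^ m * norm (complex_of_real (\<xi> $ j) * cofourier g \<xi>))"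
      by (simp add: algebra_simps sum_distrib_left norm_mult)
    also have "\<dots> \<le> C0 + (\<Sum>j\<in>UNIV. C j)"
      unfolding cofourier_coord_mult[OF Suc.prems] using C0 C by (intro add_mono sum_mono) (auto simp: norm_mult)
    finally show ?thesis .
  qed
  then show ?case by blast
qed

lemma cofourier_schwartz:
  fixes g :: "real^'n::finite \<Rightarrow> complex"
  assumes "g \<in> test_functions UNIV"
  shows "cofourier g \<in> schwartz"
  unfolding schwartz_def mem_Collect_eq
proof (intro conjI allI)
  show "smooth (cofourier g)" by (rule smooth_cofourier[OF assms])
  fix m js
  obtain g' where g': "g' \<in> test_functions UNIV" "iter_partial js (cofourier g) = cofourier g'"
    using iter_partial_cofourier[OF assms] by blast
  show "bdd_above (range (\<lambda>x. (1 + norm x) ^ m * norm (iter_partial js (cofourier g) x)))"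
    unfolding g'(2) bdd_above_def using cofourier_rapid_decay[OF g'(1)] by blast
qed

lemma integrable_prod_inverse_square:
  "integrable lborel (\<lambda>x::real^'n::finite. \<Prod>j\<in>UNIV. inverse (1 + (x $ j)\<^sup>2))"
proof -
  have "integrable lborel (\<lambda>s::real. inverse (1 + s\<^sup>2))"
    using integrable_inverse_1_plus_square by (simp add: set_integrable_def)
  then have "integrable lborel (\<lambda>s. complex_of_real (inverse (1 + s\<^sup>2)))" by (rule integrable_of_real)
  then have "integrable lborel (\<lambda>x::real^'n. \<Prod>j\<in>UNIV. complex_of_real (inverse (1 + (x $ j)\<^sup>2)))"
    by (rule integrable_prod_coords)
  from integrable_Re[OF this] show ?thesis by (simp flip: of_real_prod of_real_inverse del: of_real_add)
qed

lemma cofourier_integrable_self: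
  fixes g :: "real^'n::finite \<Rightarrow> complex"
  assumes g: "g \<in> test_functions UNIV"
  shows "integrable lborel (cofourier g)"
proof -
  \<comment> \<open>Two powers of the weight for each coordinate dominate the product of the \<open>1 + \<xi>\<^sub>j\<^sup>2\<close>.\<close>
  obtain C where C: "\<And>\<xi>. (1 + norm \<xi>) ^ (2 * CARD('n)) * norm (cofourier g \<xi>) \<le> C"
    using cofourier_rapid_decay[OF g] by blast
  show ?thesis
  proof (rule Bochner_Integration.integrable_bound)
    show "integrable lborel (\<lambda>x::real^'n. C * (\<Prod>j\<in>UNIV. inverse (1 + (x $ j)\<^sup>2)))"
      by (intro integrable_mult_right integrable_prod_inverse_square)
    show "cofourier g \<in> borel_measurable lborel"
      using borel_measurable_continuous_onI[OF smooth_continuous_on[OF smooth_cofourier[OF g]]] by simp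
    show "AE \<xi> in lborel. norm (cofourier g \<xi>) \<le> norm (C * (\<Prod>j\<in>UNIV. inverse (1 + (\<xi> $ j)\<^sup>2)))"
    proof (rule AE_I2)
      fix \<xi> :: "real^'n"
      let ?P = "\<Prod>j\<in>UNIV. (1 + (\<xi> $ j)\<^sup>2)"
      have P: "?P > 0" by (intro prod_pos) (auto intro: add_pos_nonneg)
      have "?P \<le> (\<Prod>j\<in>(UNIV::'n set). (1 + norm \<xi>)\<^sup>2)"
      proof (rule prod_mono, safe)
        fix j
        have "(\<xi> $ j)\<^sup>2 \<le> (norm \<xi>)\<^sup>2" using component_le_norm_cart[of \<xi> j] by (metis abs_le_square_iff abs_norm_cancel)
        then show "1 + (\<xi> $ j)\<^sup>2 \<le> (1 + norm \<xi>)\<^sup>2"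
          using norm_ge_zero[of \<xi>] by (simp only: power2_sum power_one)
      qed simp
      also have "\<dots> = (1 + norm \<xi>) ^ (2 * CARD('n))" by (simp add: power_mult)
      finally have "?P * norm (cofourier g \<xi>) \<le> C"
        by (rule order_trans[OF mult_right_mono C]) simp
      then have "norm (cofourier g \<xi>) \<le> C * inverse ?P" using P by (simp add: field_simps)
      also have "\<dots> \<le> norm (C * (\<Prod>j\<in>UNIV. inverse (1 + (\<xi> $ j)\<^sup>2)))"
        by (simp add: prod_inversef[symmetric] o_def)
      finally show "norm (cofourier g \<xi>) \<le> norm (C * (\<Prod>j\<in>UNIV. inverse (1 + (\<xi> $ j)\<^sup>2)))" .
    qed
  qed
qed


text \<open>Fourier inversion. Insert the Gaussian factor \<open>exp (- (\<delta> * norm \<xi>)\<^sup>2 / 2)\<close> into the outer integral: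
  Fubini turns the result into an average of \<open>g\<close> against a Gaussian of width \<open>\<delta>\<close> around \<open>x\<close>,
  and both sides converge by dominated convergence as \<open>\<delta>\<close> tends to zero.\<close>

lemma fourier_cofourier:
  fixes g :: "real^'n::finite \<Rightarrow> complex"
  assumes g: "g \<in> test_functions UNIV"
  shows "fourier (cofourier g) x = complex_of_real ((2 * pi) ^ CARD('n)) * g x"
proof -
  let ?N = "CARD('n)"
  define \<delta> where "\<delta> n = 1 / real (Suc n)" for n
  have \<delta>: "\<delta> n > 0" for n by (simp add: \<delta>_def)
  have \<delta>0: "\<delta> \<longlonglongrightarrow> 0" unfolding \<delta>_def by (rule LIMSEQ_inverse_real_of_nat[unfolded inverse_eq_divide])
  have intg: "integrable lborel g" by (rule test_functions_integrable[OF g])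
  have int_cof: "integrable lborel (cofourier g)" by (rule cofourier_integrable_self[OF g])
  have [measurable]: "g \<in> borel_measurable borel" "cofourier g \<in> borel_measurable borel"
    using intg int_cof by simp_all
  let ?e = "\<lambda>x \<xi>. exp (\<i> * complex_of_real (x \<bullet> \<xi>))"
  let ?G = "\<lambda>t (z::real^'n). complex_of_real (exp (- (t * norm z)\<^sup>2 / 2))"
  define A where "A n = (LINT \<xi>|lborel. cofourier g \<xi> * ?e (- x) \<xi> * ?G (\<delta> n) \<xi>)" for n
  have "A \<longlonglongrightarrow> (LINT \<xi>|lborel. cofourier g \<xi> * ?e (- x) \<xi>)"
    unfolding A_def
  proof (rule integral_dominated_convergence[where w = "\<lambda>\<xi>. norm (cofourier g \<xi>)"])
    show "AE \<xi> in lborel. (\<lambda>n. cofourier g \<xi> * ?e (- x) \<xi> * ?G (\<delta> n) \<xi>) \<longlonglongrightarrow> cofourier g \<xi> * ?e (- x) \<xi>"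
    proof (rule AE_I2)
      fix \<xi>
      have "(\<lambda>n. cofourier g \<xi> * ?e (- x) \<xi> * ?G (\<delta> n) \<xi>) \<longlonglongrightarrow> cofourier g \<xi> * ?e (- x) \<xi> * ?G 0 \<xi>"
        by (intro tendsto_intros \<delta>0) auto
      then show "(\<lambda>n. cofourier g \<xi> * ?e (- x) \<xi> * ?G (\<delta> n) \<xi>) \<longlonglongrightarrow> cofourier g \<xi> * ?e (- x) \<xi>" by simp
    qed
  qed (use int_cof in \<open>auto simp: norm_mult intro!: mult_left_le\<close>)
  then have lim1: "A \<longlonglongrightarrow> fourier (cofourier g) x"
    by (simp add: fourier_def inner_commute)
  have A_eq: "A n = complex_of_real (sqrt (2 * pi) ^ ?N) * (LINT z|lborel. g (x + \<delta> n *\<^sub>R z) * ?G 1 z)" for n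
  proof -
    let ?h = "\<lambda>\<xi> y. g y * (?G (\<delta> n) \<xi> * ?e \<xi> (y - x))"
    have intG: "integrable lborel (?G (\<delta> n))"
      using gaussian_fourier(1)[OF \<delta>, of n "0 :: real^'n"] by simp
    have int2: "integrable (lborel \<Otimes>\<^sub>M lborel) (case_prod ?h)"
      by (rule Bochner_Integration.integrable_bound[OF integrable_tensor[OF intG intg]])
         (auto simp: norm_mult mult.commute)
    have "A n = (LINT \<xi>|lborel. LINT y|lborel. ?h \<xi> y)"
      unfolding A_def
    proof (rule Bochner_Integration.integral_cong[OF refl])
      fix \<xi>
      have "cofourier g \<xi> * ?e (- x) \<xi> * ?G (\<delta> n) \<xi> = (LINT y|lborel. (?e (- x) \<xi> * ?G (\<delta> n) \<xi>) * (g y * ?e y \<xi>))"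
        unfolding cofourier_def integral_mult_right_zero by (simp only: mult_ac)
      also have "\<dots> = (LINT y|lborel. ?h \<xi> y)"
        by (rule Bochner_Integration.integral_cong)
           (auto simp: inner_diff_right inner_commute exp_diff exp_minus field_simps)
      finally show "cofourier g \<xi> * ?e (- x) \<xi> * ?G (\<delta> n) \<xi> = (LINT y|lborel. ?h \<xi> y)" .
    qed
    also have "\<dots> = (LINT y|lborel. LINT \<xi>|lborel. ?h \<xi> y)"
      by (rule lborel_pair.Fubini_integral[OF int2, symmetric])
    also have "\<dots> = (LINT y|lborel. complex_of_real ((sqrt (2 * pi) / \<delta> n) ^ ?N) * (g y * ?G (1 / \<delta> n) (y - x)))"
      by (rule Bochner_Integration.integral_cong[OF refl])
         (simp only: integral_mult_right_zero gaussian_fourier(2)[OF \<delta>], simp)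
    also have "\<dots> = complex_of_real ((sqrt (2 * pi) / \<delta> n) ^ ?N) * (LINT y|lborel. g y * ?G (1 / \<delta> n) (y - x))"
      by simp
    also have "(LINT y|lborel. g y * ?G (1 / \<delta> n) (y - x))
        = (LINT y|density (distr lborel borel (\<lambda>z. x + \<delta> n *\<^sub>R z)) (\<lambda>_. \<bar>\<delta> n\<bar> ^ DIM(real^'n)). g y * ?G (1 / \<delta> n) (y - x))"
      using lborel_affine[of "\<delta> n" x] \<delta>[of n] by simp
    also have "\<dots> = (LINT y|distr lborel borel (\<lambda>z. x + \<delta> n *\<^sub>R z). (\<delta> n) ^ ?N *\<^sub>R (g y * ?G (1 / \<delta> n) (y - x)))"
      using \<delta>[of n] by (subst ennreal_power[symmetric] integral_density; simp)
    also have "\<dots> = (LINT z|lborel. (\<delta> n) ^ ?N *\<^sub>R (g (x + \<delta> n *\<^sub>R z) * ?G 1 z))"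
      using \<delta>[of n] by (subst integral_distr) (auto simp: power_mult_distrib)
    also have "\<dots> = complex_of_real ((\<delta> n) ^ ?N) * (LINT z|lborel. g (x + \<delta> n *\<^sub>R z) * ?G 1 z)"
      by (simp add: scaleR_conv_of_real)
    finally show ?thesis using \<delta>[of n] by (simp add: power_divide)
  qed
  obtain B where B: "\<And>x. norm (g x) \<le> B" using test_functions_bounded[OF g] by blast
  have intG1: "integrable lborel (?G 1)" and valG1: "(LINT z|lborel. ?G 1 z) = complex_of_real (sqrt (2 * pi) ^ ?N)"
    using gaussian_fourier[of 1 "0 :: real^'n"] by simp_all
  have "(\<lambda>n. LINT z|lborel. g (x + \<delta> n *\<^sub>R z) * ?G 1 z) \<longlonglongrightarrow> (LINT z|lborel. g x * ?G 1 z)"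
  proof (rule integral_dominated_convergence[where w = "\<lambda>z. B * norm (?G 1 z)"])
    show "integrable lborel (\<lambda>z. B * norm (?G 1 z))"
      by (intro integrable_mult_right integrable_norm intG1)
    show "AE z in lborel. (\<lambda>n. g (x + \<delta> n *\<^sub>R z) * ?G 1 z) \<longlonglongrightarrow> g x * ?G 1 z"
    proof (rule AE_I2)
      fix z
      have "isCont g x"
        using smooth_differentiable[OF test_functions_smooth[OF g]] differentiable_imp_continuous_within by blast
      moreover have "(\<lambda>n. x + \<delta> n *\<^sub>R z) \<longlonglongrightarrow> x + 0 *\<^sub>R z" by (intro tendsto_intros \<delta>0)
      ultimately have "(\<lambda>n. g (x + \<delta> n *\<^sub>R z)) \<longlonglongrightarrow> g x" by (intro isCont_tendsto_compose[of x g]) auto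
      then show "(\<lambda>n. g (x + \<delta> n *\<^sub>R z) * ?G 1 z) \<longlonglongrightarrow> g x * ?G 1 z" by (intro tendsto_intros)
    qed
    show "AE z in lborel. norm (g (x + \<delta> n *\<^sub>R z) * ?G 1 z) \<le> B * norm (?G 1 z)" for n
      by (rule AE_I2) (simp add: norm_mult B mult_right_mono)
  qed measurable
  then have "(\<lambda>n. LINT z|lborel. g (x + \<delta> n *\<^sub>R z) * ?G 1 z) \<longlonglongrightarrow> g x * complex_of_real (sqrt (2 * pi) ^ ?N)"
    using valG1 by simp
  then have "A \<longlonglongrightarrow> complex_of_real (sqrt (2 * pi) ^ ?N) * (g x * complex_of_real (sqrt (2 * pi) ^ ?N))"
    unfolding A_eq by (intro tendsto_intros)
  with lim1 have "fourier (cofourier g) x = complex_of_real (sqrt (2 * pi) ^ ?N) * (g x * complex_of_real (sqrt (2 * pi) ^ ?N))"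
    by (rule LIMSEQ_unique)
  also have "\<dots> = complex_of_real ((sqrt (2 * pi) * sqrt (2 * pi)) ^ ?N) * g x"
    unfolding power_mult_distrib of_real_mult by (simp only: mult_ac)
  finally show ?thesis by simp
qed

text \<open>The value of a distribution at a test function \<open>\<psi>\<close> is determined by its Fourier transform, since
  \<open>\<psi>\<close> is the Fourier transform of a Schwartz function.\<close>

lemma has_fourier_transform_test_function:
  fixes \<psi> :: "real^'n::finite \<Rightarrow> complex"
  assumes T: "has_fourier_transform T m" and \<psi>: "\<psi> \<in> test_functions UNIV"
  shows "integrable lborel (\<lambda>\<xi>. complex_of_real (m \<xi>) * cofourier \<psi> \<xi>)"
    and "T \<psi> = complex_of_real (1 / (2 * pi) ^ CARD('n)) * (LINT \<xi>|lborel. complex_of_real (m \<xi>) * cofourier \<psi> \<xi>)"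
proof -
  let ?c = "complex_of_real (1 / (2 * pi) ^ CARD('n))"
  have g: "(\<lambda>x. ?c * \<psi> x) \<in> test_functions UNIV" by (rule test_functions_cmult[OF \<psi>])
  have "fourier (cofourier (\<lambda>x. ?c * \<psi> x)) = \<psi>"
    unfolding fourier_cofourier[OF g] fun_eq_iff mult.assoc[symmetric] of_real_mult[symmetric] by simp
  moreover have cofourier: "cofourier (\<lambda>x. ?c * \<psi> x) = (\<lambda>\<xi>. ?c * cofourier \<psi> \<xi>)"
    by (rule ext) (rule cofourier_cmult)
  ultimately have "T \<psi> = fourier_dist T (\<lambda>\<xi>. ?c * cofourier \<psi> \<xi>)" by (simp add: fourier_dist_def)
  also have "\<dots> = dist_of_fun (\<lambda>\<xi>. complex_of_real (m \<xi>)) (\<lambda>\<xi>. ?c * cofourier \<psi> \<xi>)"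
    using T cofourier_schwartz[OF g] unfolding has_fourier_transform_def cofourier by blast
  also have "\<dots> = ?c * (LINT \<xi>|lborel. complex_of_real (m \<xi>) * cofourier \<psi> \<xi>)"
    unfolding dist_of_fun_def by (subst integral_mult_right_zero[symmetric]) (simp only: mult_ac)
  finally show "T \<psi> = ?c * (LINT \<xi>|lborel. complex_of_real (m \<xi>) * cofourier \<psi> \<xi>)" .
  show "integrable lborel (\<lambda>\<xi>. complex_of_real (m \<xi>) * cofourier \<psi> \<xi>)"
    using T cofourier_schwartz[OF \<psi>] unfolding has_fourier_transform_def by blast
qed


section \<open>Smooth bumps and uniqueness of the representing function\<close>

text \<open>The flat function \<open>exp (- 1 / s)\<close>, together with the negative powers of \<open>s\<close> that its derivatives
  produce.\<close>

definition flat :: "nat \<Rightarrow> real \<Rightarrow> real" where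
  "flat m s = (if s > 0 then exp (- (1 / s)) / s ^ m else 0)"

lemma flat_tendsto_0: "(flat m \<longlongrightarrow> 0) (at 0)"
proof (rule filterlim_split_at)
  have "\<forall>\<^sub>F s in at_left 0. flat m s = 0"
    by (auto simp: flat_def eventually_at_filter)
  then show "(flat m \<longlongrightarrow> 0) (at_left 0)" by (rule tendsto_eventually)
  have "((\<lambda>s::real. inverse s ^ m / exp (inverse s)) \<longlongrightarrow> 0) (at_right 0)"
    by (rule filterlim_compose[OF tendsto_power_div_exp_0 filterlim_inverse_at_top_right])
  moreover have "\<forall>\<^sub>F s in at_right (0::real). inverse s ^ m / exp (inverse s) = flat m s"
    by (auto simp: flat_def eventually_at_filter exp_minus field_simps)
  ultimately show "(flat m \<longlongrightarrow> 0) (at_right 0)" by (rule Lim_transform_eventually)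
qed

lemma flat_has_derivative:
  "(flat m has_real_derivative - real m * flat (m + 1) s + flat (m + 2) s) (at s)"
proof -
  consider "s < 0" | "s = 0" | "s > 0" by linarith
  then show ?thesis
  proof cases
    case 1
    have "((\<lambda>s. 0) has_real_derivative 0) (at s)" by simp
    then have "(flat m has_real_derivative 0) (at s)"
      by (rule has_field_derivative_transform_within_open[where S = "{..<0}"]) (use 1 in \<open>auto simp: flat_def\<close>)
    then show ?thesis using 1 by (simp add: flat_def)
  next
    case 2
    have "\<forall>\<^sub>F h in at 0. flat (m + 1) h = (flat m (0 + h) - flat m 0) / h"
      by (auto simp: flat_def eventually_at_filter)
    with flat_tendsto_0 have "((\<lambda>h. (flat m (0 + h) - flat m 0) / h) \<longlongrightarrow> 0) (at 0)"
      by (rule Lim_transform_eventually)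
    then have "(flat m has_real_derivative 0) (at 0)" by (simp add: DERIV_def)
    then show ?thesis using 2 by (simp add: flat_def)
  next
    case 3
    have "((\<lambda>s. exp (- (1 / s)) / s ^ m) has_real_derivative
        - real m * flat (m + 1) s + flat (m + 2) s) (at s)"
      using 3 by (auto intro!: derivative_eq_intros simp: flat_def divide_simps power2_eq_square)
         (cases m; simp add: algebra_simps power2_eq_square)
    then show ?thesis
      by (rule has_field_derivative_transform_within_open[where S = "{0<..}"]) (use 3 in \<open>auto simp: flat_def\<close>)
  qed
qed

text \<open>The smallest class that contains the radial bumps and is closed under the operations occurring in
  their partial derivatives; it serves as the stable class of lemma \<open>smoothI\<close>.\<close>

inductive_set bump_algebra :: "real^'n::finite \<Rightarrow> real \<Rightarrow> (real^'n \<Rightarrow> complex) set" for c \<epsilon> where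
  flat: "(\<lambda>x. complex_of_real (flat m (\<epsilon>\<^sup>2 - (norm (x - c))\<^sup>2))) \<in> bump_algebra c \<epsilon>"
| add: "f \<in> bump_algebra c \<epsilon> \<Longrightarrow> g \<in> bump_algebra c \<epsilon> \<Longrightarrow> (\<lambda>x. f x + g x) \<in> bump_algebra c \<epsilon>"
| cmult: "f \<in> bump_algebra c \<epsilon> \<Longrightarrow> (\<lambda>x. b * f x) \<in> bump_algebra c \<epsilon>"
| coord: "f \<in> bump_algebra c \<epsilon> \<Longrightarrow> (\<lambda>x. complex_of_real (x $ i) * f x) \<in> bump_algebra c \<epsilon>"

lemma flat_ball_has_derivative:
  fixes c :: "real^'n::finite"
  shows "((\<lambda>x. complex_of_real (flat m (\<epsilon>\<^sup>2 - (norm (x - c))\<^sup>2))) has_derivative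
    (\<lambda>h. complex_of_real (- 2 * ((x - c) \<bullet> h) *
       (- real m * flat (m + 1) (\<epsilon>\<^sup>2 - (norm (x - c))\<^sup>2) + flat (m + 2) (\<epsilon>\<^sup>2 - (norm (x - c))\<^sup>2))))) (at x)"
proof -
  have 1: "((\<lambda>x. \<epsilon>\<^sup>2 - (norm (x - c))\<^sup>2) has_derivative (\<lambda>h. - 2 * ((x - c) \<bullet> h))) (at x)"
    unfolding power2_norm_eq_inner by (auto intro!: derivative_eq_intros simp: inner_commute)
  have 2: "(flat m has_derivative (\<lambda>h. (- real m * flat (m + 1) s + flat (m + 2) s) * h)) (at s)" for s
    using flat_has_derivative unfolding has_field_derivative_def .
  have "((\<lambda>x. flat m (\<epsilon>\<^sup>2 - (norm (x - c))\<^sup>2)) has_derivative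
    (\<lambda>h. - 2 * ((x - c) \<bullet> h) *
       (- real m * flat (m + 1) (\<epsilon>\<^sup>2 - (norm (x - c))\<^sup>2) + flat (m + 2) (\<epsilon>\<^sup>2 - (norm (x - c))\<^sup>2)))) (at x)"
    using has_derivative_compose[OF 1 2] by (simp only: mult.commute)
  from bounded_linear.has_derivative[OF bounded_linear_of_real this] show ?thesis by simp
qed

lemma bump_algebra_partial_deriv:
  fixes c :: "real^'n::finite"
  assumes "f \<in> bump_algebra c \<epsilon>"
  shows "(\<forall>x. f differentiable (at x)) \<and> (\<forall>j. partial_deriv j f \<in> bump_algebra c \<epsilon>)"
  using assms
proof induction
  case (flat m)
  let ?F = "\<lambda>m x. complex_of_real (flat m (\<epsilon>\<^sup>2 - (norm (x - c))\<^sup>2))"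
  have "partial_deriv j (?F m) \<in> bump_algebra c \<epsilon>" for j
  proof -
    let ?D = "\<lambda>x. of_real (- real m) * ?F (m + 1) x + ?F (m + 2) x"
    have "partial_deriv j (?F m) = (\<lambda>x. - 2 * (complex_of_real (x $ j) * ?D x) + 2 * complex_of_real (c $ j) * ?D x)"
      by (rule ext) (simp add: partial_deriv_eqI[OF flat_ball_has_derivative] inner_axis algebra_simps)
    moreover have "(\<lambda>x. - 2 * (complex_of_real (x $ j) * ?D x) + 2 * complex_of_real (c $ j) * ?D x) \<in> bump_algebra c \<epsilon>"
      by (intro bump_algebra.intros)
    ultimately show ?thesis by simp
  qed
  then show ?case using differentiableI[OF flat_ball_has_derivative] by blast
next
  case (add f g)
  then have "partial_deriv j (\<lambda>x. f x + g x) = (\<lambda>x. partial_deriv j f x + partial_deriv j g x)" for j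
    by (simp add: partial_deriv_add fun_eq_iff)
  with add show ?case by (auto intro!: bump_algebra.add differentiable_add)
next
  case (cmult f b)
  then have "partial_deriv j (\<lambda>x. b * f x) = (\<lambda>x. b * partial_deriv j f x)" for j
    by (simp add: partial_deriv_cmult fun_eq_iff)
  with cmult show ?case by (auto intro!: bump_algebra.cmult derivative_intros)
next
  case (coord f i)
  then have "partial_deriv j (\<lambda>x. complex_of_real (x $ i) * f x)
    = (\<lambda>x. complex_of_real (x $ i) * partial_deriv j f x + of_bool (i = j) * f x)" for j
    by (simp add: partial_deriv_coord_mult fun_eq_iff)
  moreover have "(\<lambda>x. complex_of_real (x $ i) * f x) differentiable (at x)" for x
    using coord.IH has_derivative_coord_mult unfolding differentiable_def by blast
  ultimately show ?case using coord by (auto intro!: bump_algebra.add bump_algebra.cmult bump_algebra.coord)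
qed

definition bump :: "real^'n::finite \<Rightarrow> real \<Rightarrow> real^'n \<Rightarrow> real" where
  "bump c \<epsilon> x = flat 0 (\<epsilon>\<^sup>2 - (norm (x - c))\<^sup>2)"

lemma bump_nonneg: "0 \<le> bump c \<epsilon> x" by (simp add: bump_def flat_def)

lemma bump_pos_iff: "\<epsilon> > 0 \<Longrightarrow> 0 < bump c \<epsilon> x \<longleftrightarrow> x \<in> ball c \<epsilon>"
  using norm_ge_zero[of "x - c"] power2_less_imp_less[of "norm (x - c)" \<epsilon>]
    power_strict_mono[of "norm (x - c)" \<epsilon> 2]
  by (auto simp: bump_def flat_def dist_norm norm_minus_commute)

lemma bump_test_function:
  fixes c :: "real^'n::finite"
  assumes "\<epsilon> > 0" "cball c \<epsilon> \<subseteq> U"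
  shows "(\<lambda>x. complex_of_real (bump c \<epsilon> x)) \<in> test_functions U"
proof -
  have "(\<lambda>x. complex_of_real (bump c \<epsilon> x)) \<in> bump_algebra c \<epsilon>"
    unfolding bump_def by (rule bump_algebra.flat)
  then have "smooth (\<lambda>x. complex_of_real (bump c \<epsilon> x))"
    by (rule smoothI) (use bump_algebra_partial_deriv in blast)+
  moreover have "{x. complex_of_real (bump c \<epsilon> x) \<noteq> 0} = ball c \<epsilon>"
    using bump_pos_iff[OF assms(1), of c] bump_nonneg[of c \<epsilon>] by (auto simp: less_le)
  ultimately show ?thesis using assms by (simp add: test_functions_def)
qed

text \<open>The fundamental lemma of the calculus of variations: if the difference \<open>d\<close> of the two functions
  does not vanish at \<open>x\<close>, then the real part of \<open>cnj (d x) * d\<close> is positive near \<open>x\<close> and testing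
  against a bump supported there gives a contradiction.\<close>

lemma continuous_restriction_unique:
  fixes T :: "(real^'n::finite \<Rightarrow> complex) \<Rightarrow> complex"
  assumes h1: "continuous_restriction T U h1" and h2: "continuous_restriction T U h2"
    and "open U" "x \<in> U"
  shows "h1 x = h2 x"
proof (rule ccontr)
  assume ne: "h1 x \<noteq> h2 x"
  define d where "d y = h1 y - h2 y" for y
  have cont: "continuous_on U h1" "continuous_on U h2" "continuous_on U d"
    using h1 h2 by (auto simp: continuous_restriction_def d_def intro!: continuous_intros)
  have "isCont d x"
    using cont(3) \<open>open U\<close> \<open>x \<in> U\<close> continuous_on_eq_continuous_at by blast
  then have "((\<lambda>y. Re (cnj (d x) * d y)) \<longlongrightarrow> Re (cnj (d x) * d x)) (nhds x)"
    unfolding isCont_def tendsto_at_iff_tendsto_nhds by (intro tendsto_intros)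
  moreover have "Re (cnj (d x) * d x) > 0"
  proof -
    have "Re (cnj (d x) * d x) = (norm (d x))\<^sup>2"
      unfolding cmod_power2 by (simp add: power2_eq_square)
    then show ?thesis using ne by (simp add: d_def)
  qed
  ultimately have "\<forall>\<^sub>F y in nhds x. 0 < Re (cnj (d x) * d y)"
    by (rule order_tendstoD(1))
  then obtain e1 where e1: "e1 > 0" "\<And>y. dist y x < e1 \<Longrightarrow> 0 < Re (cnj (d x) * d y)"
    by (auto simp: eventually_nhds_metric)
  obtain e2 where e2: "e2 > 0" "ball x e2 \<subseteq> U" using \<open>open U\<close> \<open>x \<in> U\<close> openE by blast
  \<comment> \<open>Half the radius, so that the closed ball is still contained in both open balls.\<close>
  define \<epsilon> where "\<epsilon> = min e1 e2 / 2"
  have \<epsilon>: "\<epsilon> > 0" "\<epsilon> < e1" "\<epsilon> < e2" using e1 e2 by (auto simp: \<epsilon>_def)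
  have sub: "cball x \<epsilon> \<subseteq> U" using \<epsilon> e2 by fastforce
  have b0: "bump x \<epsilon> y = 0" if "y \<notin> cball x \<epsilon>" for y
    using that bump_pos_iff[OF \<epsilon>(1), of x y] bump_nonneg[of x \<epsilon> y] by auto
  have test: "(\<lambda>y. complex_of_real (bump x \<epsilon> y)) \<in> test_functions U"
    by (rule bump_test_function[OF \<epsilon>(1) sub])
  have int: "integrable lborel (\<lambda>y. h y * complex_of_real (bump x \<epsilon> y))" if "continuous_on U h" for h
    by (rule continuous_vanishing_integrable[where S = "cball x \<epsilon>"])
       (use sub that b0 smooth_continuous_on[OF test_functions_smooth[OF test]]
         in \<open>auto intro!: continuous_intros intro: continuous_on_subset\<close>)
  have "(LINT y|lborel. h1 y * complex_of_real (bump x \<epsilon> y)) = (LINT y|lborel. h2 y * complex_of_real (bump x \<epsilon> y))"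
    using h1 h2 test unfolding continuous_restriction_def dist_of_fun_def by metis
  then have "(LINT y|lborel. d y * complex_of_real (bump x \<epsilon> y)) = 0"
    unfolding d_def left_diff_distrib by (simp add: Bochner_Integration.integral_diff int cont)
  then have "(LINT y|lborel. cnj (d x) * (d y * complex_of_real (bump x \<epsilon> y))) = 0"
    by simp
  moreover have intd: "integrable lborel (\<lambda>y. cnj (d x) * (d y * complex_of_real (bump x \<epsilon> y)))"
    by (intro integrable_mult_right int cont)
  ultimately have "(LINT y|lborel. Re (cnj (d x) * (d y * complex_of_real (bump x \<epsilon> y)))) = 0"
    by (metis integral_Re zero_complex.sel(1))
  moreover have eq: "Re (cnj (d x) * (d y * complex_of_real (bump x \<epsilon> y))) = Re (cnj (d x) * d y) * bump x \<epsilon> y" for y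
    by (simp add: algebra_simps)
  moreover have nn: "0 \<le> Re (cnj (d x) * d y) * bump x \<epsilon> y" for y
    using e1(2)[of y] b0[of y] bump_nonneg[of x \<epsilon> y] \<epsilon>(2)
    by (cases "y \<in> cball x \<epsilon>") (auto simp: dist_commute intro!: mult_nonneg_nonneg less_imp_le)
  moreover have "integrable lborel (\<lambda>y. Re (cnj (d x) * d y) * bump x \<epsilon> y)"
    using integrable_Re[OF intd] unfolding eq .
  ultimately have "AE y in lborel. Re (cnj (d x) * d y) * bump x \<epsilon> y = 0"
    using integral_nonneg_eq_0_iff_AE[of lborel "\<lambda>y. Re (cnj (d x) * d y) * bump x \<epsilon> y"] by simp
  then have "AE y in lborel. y \<notin> ball x \<epsilon>"
  proof (rule AE_mp, intro AE_I2 impI notI)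
    fix y assume "Re (cnj (d x) * d y) * bump x \<epsilon> y = 0" "y \<in> ball x \<epsilon>"
    then show False using e1(2)[of y] bump_pos_iff[OF \<epsilon>(1), of x y] \<epsilon>(2) by (auto simp: dist_commute)
  qed
  then have "ball x \<epsilon> \<in> null_sets lborel" by (subst AE_iff_null_sets) auto
  then have "negligible (ball x \<epsilon>)"
    by (simp add: negligible_iff_null_sets null_sets_completion_iff)
  then show False using open_not_negligible[of "ball x \<epsilon>"] \<epsilon>(1) by auto
qed

lemma value_at_eq:
  fixes T :: "(real^'n::finite \<Rightarrow> complex) \<Rightarrow> complex"
  assumes "continuous_restriction T (- {0}) h" "x \<noteq> 0"
  shows "value_at T x = h x"
proof -
  have "open (- {0 :: real^'n})" by auto
  then show ?thesis
    unfolding value_at_def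
    by (intro the_equality) (use assms continuous_restriction_unique[of T "- {0}" _ h x] in blast)+
qed


section \<open>One-dimensional oscillatory integrals\<close>

definition quartic_fourier :: "real \<Rightarrow> real \<Rightarrow> nat \<Rightarrow> real \<Rightarrow> complex" where
  "quartic_fourier a b q y = (LINT s|lborel. complex_of_real (s ^ q * exp (- (a * s\<^sup>2 + b * s ^ 4))) * exp (\<i> * complex_of_real (s * y)))"

text \<open>Under this hypothesis \<open>a s\<^sup>2 + b s\<^sup>4\<close> becomes of order one exactly at \<open>\<bar>s\<bar>\<close> of order \<open>1 / r\<close>, so
  that \<open>r\<close> is the length scale of the Fourier transform of the weight. It covers the Gaussian
  (\<open>b = 0\<close>, \<open>r\<^sup>2 = a\<close>), and \<open>a = b = t\<close> with \<open>r ^ 4 = t\<close> for \<open>t \<le> 1\<close> and with \<open>r\<^sup>2 = t\<close> for \<open>t \<ge> 1\<close>.\<close>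

definition scaled :: "real \<Rightarrow> real \<Rightarrow> real \<Rightarrow> bool" where
  "scaled r a b \<longleftrightarrow> 0 < r \<and> 0 \<le> a \<and> 0 \<le> b \<and> a \<le> r\<^sup>2 \<and> b \<le> r ^ 4 \<and> (a = r\<^sup>2 \<or> b = r ^ 4)"

text \<open>If \<open>b = r ^ 4\<close>, the quartic term with \<open>u = r s\<close> satisfies \<open>u\<^sup>4 \<ge> 2 u\<^sup>2 - 1\<close>. Hence
  one Gaussian dominates the weight in both cases.\<close>

lemma quartic_weight_le:
  assumes "scaled r a b"
  shows "exp (- (a * s\<^sup>2 + b * s ^ 4)) \<le> exp 1 * exp (- (r * s)\<^sup>2 / 2)"
proof -
  have "(r * s)\<^sup>2 / 2 - 1 \<le> a * s\<^sup>2 + b * s ^ 4"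
  proof (cases "a = r\<^sup>2")
    case True
    have "0 \<le> b * s ^ 4" "0 \<le> r\<^sup>2 * s\<^sup>2" using assms by (auto simp: scaled_def)
    then show ?thesis unfolding True power_mult_distrib by linarith
  next
    case False
    then have "b = r ^ 4" using assms by (auto simp: scaled_def)
    then have "b * s ^ 4 = ((r * s)\<^sup>2)\<^sup>2" by (simp add: power_mult_distrib flip: power_mult)
    moreover have "0 \<le> a * s\<^sup>2" using assms by (auto simp: scaled_def)
    moreover have "0 \<le> ((r * s)\<^sup>2 - 1)\<^sup>2" by simp
    ultimately have "2 * (r * s)\<^sup>2 - 1 \<le> a * s\<^sup>2 + b * s ^ 4" by (simp add: power2_diff)
    then show ?thesis using zero_le_power2[of "r * s"] by linarith
  qed
  then show ?thesis by (simp flip: exp_add)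
qed

definition gauss_moment :: "nat \<Rightarrow> real" where
  "gauss_moment q = (LINT s|lborel. \<bar>s\<bar> ^ q * exp (- s\<^sup>2 / 2))"

lemma gauss_moment_integrable: "integrable lborel (\<lambda>s::real. \<bar>s\<bar> ^ q * exp (- s\<^sup>2 / 2))"
proof -
  have "integrable lborel (\<lambda>s. sqrt (2 * pi) * (std_normal_density s * \<bar>s\<bar> ^ q))"
    by (rule integrable_mult_right) (rule integrable_std_normal_moment_abs)
  then show ?thesis by (simp add: std_normal_density_def mult.commute)
qed

lemma gauss_moment_scaled:
  assumes "r > 0"
  shows "integrable lborel (\<lambda>s::real. \<bar>s\<bar> ^ q * exp (- (r * s)\<^sup>2 / 2))"
    and "(LINT s|lborel. \<bar>s\<bar> ^ q * exp (- (r * s)\<^sup>2 / 2)) * r ^ (q + 1) = gauss_moment q"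
proof -
  let ?g = "\<lambda>s::real. \<bar>s\<bar> ^ q * exp (- s\<^sup>2 / 2)"
  have g: "?g (0 + r * s) = r ^ q * (\<bar>s\<bar> ^ q * exp (- (r * s)\<^sup>2 / 2))" for s
    using assms by (simp add: abs_mult power_mult_distrib)
  have "integrable lborel (\<lambda>s. ?g (0 + r * s))"
    by (rule lborel_integrable_real_affine[OF gauss_moment_integrable]) (use assms in simp)
  then have "integrable lborel (\<lambda>s. inverse (r ^ q) * (r ^ q * (\<bar>s\<bar> ^ q * exp (- (r * s)\<^sup>2 / 2))))"
    unfolding g by (rule integrable_mult_right)
  moreover have "inverse (r ^ q) * (r ^ q * z) = z" for z using assms by simp
  ultimately show "integrable lborel (\<lambda>s::real. \<bar>s\<bar> ^ q * exp (- (r * s)\<^sup>2 / 2))" by simp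
  have "gauss_moment q = \<bar>r\<bar> *\<^sub>R (LINT s|lborel. ?g (0 + r * s))"
    unfolding gauss_moment_def by (rule lborel_integral_real_affine) (use assms in simp)
  also have "\<dots> = r * (r ^ q * (LINT s|lborel. \<bar>s\<bar> ^ q * exp (- (r * s)\<^sup>2 / 2)))"
    unfolding g using assms by simp
  finally show "(LINT s|lborel. \<bar>s\<bar> ^ q * exp (- (r * s)\<^sup>2 / 2)) * r ^ (q + 1) = gauss_moment q"
    by (simp add: mult_ac)
qed

lemma quartic_fourier_integrand_bound:
  assumes "scaled r a b"
  shows "norm (complex_of_real (s ^ q * exp (- (a * s\<^sup>2 + b * s ^ 4))) * exp (\<i> * complex_of_real (s * y)))
    \<le> exp 1 * (\<bar>s\<bar> ^ q * exp (- (r * s)\<^sup>2 / 2))"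
proof -
  have "norm (complex_of_real (s ^ q * exp (- (a * s\<^sup>2 + b * s ^ 4))) * exp (\<i> * complex_of_real (s * y)))
     = \<bar>s\<bar> ^ q * exp (- (a * s\<^sup>2 + b * s ^ 4))"
    unfolding norm_mult norm_of_real norm_exp_i by (simp add: abs_mult power_abs)
  also have "\<dots> \<le> \<bar>s\<bar> ^ q * (exp 1 * exp (- (r * s)\<^sup>2 / 2))"
    by (rule mult_left_mono[OF quartic_weight_le[OF assms]]) simp
  finally show ?thesis by (simp add: mult_ac)
qed

lemma quartic_fourier_integrable:
  assumes "scaled r a b"
  shows "integrable lborel (\<lambda>s. complex_of_real (s ^ q * exp (- (a * s\<^sup>2 + b * s ^ 4))) * exp (\<i> * complex_of_real (s * y)))"
proof (rule Bochner_Integration.integrable_bound)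
  show "integrable lborel (\<lambda>s. exp 1 * (\<bar>s\<bar> ^ q * exp (- (r * s)\<^sup>2 / 2)))"
    using assms by (intro integrable_mult_right gauss_moment_scaled) (simp add: scaled_def)
  show "AE s in lborel. norm (complex_of_real (s ^ q * exp (- (a * s\<^sup>2 + b * s ^ 4))) * exp (\<i> * complex_of_real (s * y)))
    \<le> norm (exp 1 * (\<bar>s\<bar> ^ q * exp (- (r * s)\<^sup>2 / 2)))"
    by (intro AE_I2 order_trans[OF quartic_fourier_integrand_bound[OF assms]]) simp
qed measurable

lemma quartic_fourier_bound_0:
  assumes "scaled r a b"
  shows "norm (quartic_fourier a b q y) * r ^ (q + 1) \<le> exp 1 * gauss_moment q"
proof -
  have r: "r > 0" using assms by (simp add: scaled_def)
  have "norm (quartic_fourier a b q y) \<le> (LINT s|lborel. exp 1 * (\<bar>s\<bar> ^ q * exp (- (r * s)\<^sup>2 / 2)))"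
    unfolding quartic_fourier_def
    by (rule order_trans[OF integral_norm_bound integral_mono'])
       (use quartic_fourier_integrand_bound[OF assms] gauss_moment_scaled(1)[OF r] in \<open>auto intro!: integrable_mult_right simp: norm_mult\<close>)
  also have "\<dots> = exp 1 * (LINT s|lborel. \<bar>s\<bar> ^ q * exp (- (r * s)\<^sup>2 / 2))" by simp
  finally have "norm (quartic_fourier a b q y) * r ^ (q + 1) \<le> exp 1 * (LINT s|lborel. \<bar>s\<bar> ^ q * exp (- (r * s)\<^sup>2 / 2)) * r ^ (q + 1)"
    by (rule mult_right_mono) (use r in simp)
  then show ?thesis using gauss_moment_scaled(2)[OF r, of q] by (simp only: mult.assoc)
qed

lemma integral_derivative_eq_0:
  fixes F f :: "real \<Rightarrow> complex"
  assumes F: "\<And>s. (F has_vector_derivative f s) (at s)"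
    and cont: "\<And>s. isCont f s" and int: "integrable lborel f"
    and top: "(F \<longlongrightarrow> 0) at_top" and bot: "(F \<longlongrightarrow> 0) at_bot"
  shows "(LINT s|lborel. f s) = 0"
proof -
  have "(LBINT s=-\<infinity>..\<infinity>. f s) = 0 - 0"
    by (rule interval_integral_FTC_integrable[where F = F])
       (use assms in \<open>auto simp: set_integrable_def ereal_tendsto_simps\<close>)
  then show ?thesis
    by (simp add: interval_lebesgue_integral_def set_lebesgue_integral_def)
qed

lemma gauss_tail:
  assumes "r > 0"
  shows "((\<lambda>s::real. \<bar>s\<bar> ^ q * exp (- (r * s)\<^sup>2 / 2)) \<longlongrightarrow> 0) at_top"
    and "((\<lambda>s::real. \<bar>s\<bar> ^ q * exp (- (r * s)\<^sup>2 / 2)) \<longlongrightarrow> 0) at_bot"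
proof -
  let ?g = "\<lambda>s::real. \<bar>s\<bar> ^ q * exp (- (r * s)\<^sup>2 / 2)"
  have lim: "filterlim (\<lambda>s::real. r * s) at_top at_top"
    by (rule filterlim_tendsto_pos_mult_at_top[OF tendsto_const assms filterlim_ident])
  have "((\<lambda>s. exp 1 * ((r * s) ^ q / exp (r * s)) / r ^ q) \<longlongrightarrow> exp 1 * 0 / r ^ q) at_top"
    by (intro tendsto_intros filterlim_compose[OF tendsto_power_div_exp_0 lim]) (use assms in auto)
  then have upper: "((\<lambda>s. exp 1 * ((r * s) ^ q / exp (r * s)) / r ^ q) \<longlongrightarrow> 0) at_top" by simp
  have "\<forall>\<^sub>F s in at_top. norm (?g s) \<le> exp 1 * ((r * s) ^ q / exp (r * s)) / r ^ q"
    using eventually_gt_at_top[of 0]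
  proof eventually_elim
    case (elim s)
    have "- (r * s)\<^sup>2 / 2 \<le> 1 - r * s"
      using zero_le_power2[of "r * s - 1"] unfolding power2_diff by simp
    then have "exp (- (r * s)\<^sup>2 / 2) \<le> exp 1 / exp (r * s)" by (simp flip: exp_diff)
    then have "s ^ q * exp (- (r * s)\<^sup>2 / 2) \<le> s ^ q * (exp 1 / exp (r * s))"
      using elim by (intro mult_left_mono) auto
    then show ?case using elim assms by (simp add: power_mult_distrib mult_ac)
  qed
  then show top: "(?g \<longlongrightarrow> 0) at_top" by (rule Lim_null_comparison[OF _ upper])
  show "(?g \<longlongrightarrow> 0) at_bot"
    using top unfolding filterlim_at_bot_mirror by simp
qed

text \<open>Integration by parts; the three terms come from differentiating the power, the quadratic and the
  quartic part of the exponent.\<close>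

lemma quartic_fourier_mult_freq:
  assumes sc: "scaled r a b"
  shows "complex_of_real y * quartic_fourier a b q y = \<i> * (of_nat q * quartic_fourier a b (q - 1) y
      - 2 * of_real a * quartic_fourier a b (q + 1) y - 4 * of_real b * quartic_fourier a b (q + 3) y)"
proof -
  let ?W = "\<lambda>p s. complex_of_real (s ^ p * exp (- (a * s\<^sup>2 + b * s ^ 4))) * exp (\<i> * complex_of_real (s * y))"
  let ?f = "\<lambda>s. of_nat q * ?W (q - 1) s - 2 * of_real a * ?W (q + 1) s - 4 * of_real b * ?W (q + 3) s
     + \<i> * of_real y * ?W q s"
  have r: "r > 0" using sc by (simp add: scaled_def)
  note int = quartic_fourier_integrable[OF sc]
  have "(LINT s|lborel. ?f s) = 0"
  proof (rule integral_derivative_eq_0[where F = "?W q"])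
    fix s
    have d1: "((\<lambda>s. s ^ q * exp (- (a * s\<^sup>2 + b * s ^ 4))) has_real_derivative
      (real q * s ^ (q - 1) - 2 * a * s ^ (q + 1) - 4 * b * s ^ (q + 3)) * exp (- (a * s\<^sup>2 + b * s ^ 4))) (at s)"
      by (auto intro!: derivative_eq_intros simp: algebra_simps power_add eval_nat_numeral)
    have d2: "((\<lambda>s. exp (\<i> * complex_of_real (s * y))) has_vector_derivative
       \<i> * of_real y * exp (\<i> * complex_of_real (s * y))) (at s)"
    proof -
      have "((\<lambda>s. \<i> * complex_of_real (s * y)) has_vector_derivative \<i> * of_real y) (at s)"
        by (auto intro!: derivative_eq_intros simp: has_vector_derivative_def scaleR_conv_of_real)
      from field_vector_diff_chain_at[OF this DERIV_exp] show ?thesis by (simp add: o_def mult_ac)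
    qed
    have "((\<lambda>s. ?W q s) has_vector_derivative
       complex_of_real (s ^ q * exp (- (a * s\<^sup>2 + b * s ^ 4))) * (\<i> * of_real y * exp (\<i> * complex_of_real (s * y)))
       + complex_of_real ((real q * s ^ (q - 1) - 2 * a * s ^ (q + 1) - 4 * b * s ^ (q + 3)) * exp (- (a * s\<^sup>2 + b * s ^ 4)))
         * exp (\<i> * complex_of_real (s * y))) (at s)"
      by (intro has_vector_derivative_mult d2 has_vector_derivative_of_real d1)
    also have "complex_of_real (s ^ q * exp (- (a * s\<^sup>2 + b * s ^ 4))) * (\<i> * of_real y * exp (\<i> * complex_of_real (s * y)))
       + complex_of_real ((real q * s ^ (q - 1) - 2 * a * s ^ (q + 1) - 4 * b * s ^ (q + 3)) * exp (- (a * s\<^sup>2 + b * s ^ 4)))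
         * exp (\<i> * complex_of_real (s * y)) = ?f s"
      by (simp add: algebra_simps del: of_real_power)
    finally show "(?W q has_vector_derivative ?f s) (at s)" .
    show "isCont ?f s" by (intro continuous_intros)
  next
    show "integrable lborel ?f"
      by (intro Bochner_Integration.integrable_add Bochner_Integration.integrable_diff integrable_mult_right int)
    have "((\<lambda>s. exp 1 * (\<bar>s\<bar> ^ q * exp (- (r * s)\<^sup>2 / 2))) \<longlongrightarrow> exp 1 * 0) at_top"
      by (intro tendsto_intros gauss_tail[OF r])
    then show "(?W q \<longlongrightarrow> 0) at_top"
      by (intro Lim_null_comparison[OF always_eventually[OF allI[OF quartic_fourier_integrand_bound[OF sc]]]]) simp
    have "((\<lambda>s. exp 1 * (\<bar>s\<bar> ^ q * exp (- (r * s)\<^sup>2 / 2))) \<longlongrightarrow> exp 1 * 0) at_bot"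
      by (intro tendsto_intros gauss_tail[OF r])
    then show "(?W q \<longlongrightarrow> 0) at_bot"
      by (intro Lim_null_comparison[OF always_eventually[OF allI[OF quartic_fourier_integrand_bound[OF sc]]]]) simp
  qed
  moreover have "(LINT s|lborel. ?f s) = of_nat q * quartic_fourier a b (q - 1) y
      - 2 * of_real a * quartic_fourier a b (q + 1) y - 4 * of_real b * quartic_fourier a b (q + 3) y + \<i> * of_real y * quartic_fourier a b q y"
  proof -
    have W: "has_bochner_integral lborel (?W p) (quartic_fourier a b p y)" for p
      unfolding quartic_fourier_def by (rule has_bochner_integral_integrable[OF int])
    show ?thesis
      by (intro has_bochner_integral_integral_eq has_bochner_integral_add has_bochner_integral_diff
          has_bochner_integral_mult_right W)
  qed
  ultimately have "of_nat q * quartic_fourier a b (q - 1) y - 2 * of_real a * quartic_fourier a b (q + 1) y - 4 * of_real b * quartic_fourier a b (q + 3) y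
      = - (\<i> * of_real y * quartic_fourier a b q y)" by (simp add: eq_neg_iff_add_eq_0)
  then show ?thesis by (simp add: mult.assoc[symmetric])
qed

text \<open>The transform decays rapidly at the scale \<open>r\<close>, with a constant that does not depend on
  \<open>r\<close>, \<open>a\<close> and \<open>b\<close>. Each term of \<open>quartic_fourier_mult_freq\<close> scales in the same way: in passing from
  \<open>q\<close> to \<open>q - 1\<close>, \<open>q + 1\<close> and \<open>q + 3\<close> one gains \<open>r\<close>, loses \<open>r\<close> and loses \<open>r\<^sup>3\<close>, while the coefficients
  are bounded by a constant, \<open>r\<^sup>2\<close> and \<open>r\<^sup>4\<close>. So one induction on \<open>M\<close> treats all \<open>q\<close> at once.\<close>

lemma quartic_fourier_bound:
  "\<exists>C\<ge>0. \<forall>r a b y. scaled r a b \<longrightarrow> \<bar>y\<bar> ^ M * norm (quartic_fourier a b q y) * r ^ (q + 1) \<le> C * r ^ M"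
proof (induction M arbitrary: q)
  case 0
  have "gauss_moment q \<ge> 0" by (simp add: gauss_moment_def)
  then show ?case using quartic_fourier_bound_0[of _ _ _ q] by (intro exI[of _ "exp 1 * gauss_moment q"]) auto
next
  case (Suc M)
  obtain C where C: "\<And>q. C q \<ge> 0"
      "\<And>q r a b y. scaled r a b \<Longrightarrow> \<bar>y\<bar> ^ M * norm (quartic_fourier a b q y) * r ^ (q + 1) \<le> C q * r ^ M"
    using Suc.IH by metis
  show ?case
  proof (intro exI[of _ "real q * C (q - 1) + 2 * C (q + 1) + 4 * C (q + 3)"] conjI allI impI)
    fix r a b y assume sc: "scaled r a b"
    then have r: "0 < r" "0 \<le> a" "0 \<le> b" "a \<le> r\<^sup>2" "b \<le> r ^ 4" by (auto simp: scaled_def)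
    let ?n = "\<lambda>p. norm (quartic_fourier a b p y)"
    have "\<bar>y\<bar> * ?n q \<le> real q * ?n (q - 1) + 2 * a * ?n (q + 1) + 4 * b * ?n (q + 3)"
    proof -
      have "\<bar>y\<bar> * ?n q = norm (complex_of_real y * quartic_fourier a b q y)" by (simp add: norm_mult)
      also have "\<dots> \<le> norm (of_nat q * quartic_fourier a b (q - 1) y) + norm (2 * of_real a * quartic_fourier a b (q + 1) y)
          + norm (4 * of_real b * quartic_fourier a b (q + 3) y)"
        unfolding quartic_fourier_mult_freq[OF sc, of y q] norm_mult[of \<i>]
        by (simp only: norm_ii mult_1) (meson norm_triangle_ineq4 order_trans add_right_mono)
      finally show ?thesis using r by (simp add: norm_mult)
    qed
    note step = this
    have "\<bar>y\<bar> ^ Suc M * ?n q * r ^ (q + 1) = (\<bar>y\<bar> * ?n q) * (\<bar>y\<bar> ^ M * r ^ (q + 1))" by simp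
    also have "\<dots> \<le> (real q * ?n (q - 1) + 2 * a * ?n (q + 1) + 4 * b * ?n (q + 3)) * (\<bar>y\<bar> ^ M * r ^ (q + 1))"
      by (rule mult_right_mono[OF step]) (use r in simp)
    also have "\<dots> = real q * (\<bar>y\<bar> ^ M * ?n (q - 1) * r ^ (q + 1)) + a * (2 * (\<bar>y\<bar> ^ M * ?n (q + 1) * r ^ (q + 1)))
        + b * (4 * (\<bar>y\<bar> ^ M * ?n (q + 3) * r ^ (q + 1)))"
      by (simp add: algebra_simps)
    also have "\<dots> \<le> real q * (C (q - 1) * r ^ Suc M) + r\<^sup>2 * (2 * (\<bar>y\<bar> ^ M * ?n (q + 1) * r ^ (q + 1)))
        + r ^ 4 * (4 * (\<bar>y\<bar> ^ M * ?n (q + 3) * r ^ (q + 1)))"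
    proof (intro add_mono mult_right_mono)
      show "real q * (\<bar>y\<bar> ^ M * ?n (q - 1) * r ^ (q + 1)) \<le> real q * (C (q - 1) * r ^ Suc M)"
      proof (cases q)
        case (Suc p)
        have "\<bar>y\<bar> ^ M * ?n p * r ^ (p + 1) * r \<le> C p * r ^ M * r"
          using C(2)[OF sc, of y p] r by (intro mult_right_mono) auto
        then show ?thesis using Suc by (intro mult_left_mono) (simp_all add: mult_ac)
      qed simp
    qed (use r in auto)
    also have "\<dots> = real q * (C (q - 1) * r ^ Suc M) + 2 * r * (\<bar>y\<bar> ^ M * ?n (q + 1) * r ^ (q + 1 + 1))
        + 4 * r * (\<bar>y\<bar> ^ M * ?n (q + 3) * r ^ (q + 3 + 1))"
      by (simp add: eval_nat_numeral mult_ac)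
    also have "\<dots> \<le> real q * (C (q - 1) * r ^ Suc M) + 2 * r * (C (q + 1) * r ^ M) + 4 * r * (C (q + 3) * r ^ M)"
      by (intro add_mono mult_left_mono C(2)[OF sc]) (use r C(1) in auto)
    also have "\<dots> = (real q * C (q - 1) + 2 * C (q + 1) + 4 * C (q + 3)) * r ^ Suc M"
      by (simp add: algebra_simps)
    finally show "\<bar>y\<bar> ^ Suc M * ?n q * r ^ (q + 1) \<le> \<dots>" .
  qed (use C in auto)
qed

lemma quartic_fourier_continuous:
  assumes "scaled r a b"
  shows "continuous_on UNIV (quartic_fourier a b q)"
proof (rule continuous_on_sequentiallyI)
  fix u :: "nat \<Rightarrow> real" and y assume u: "u \<longlonglongrightarrow> y"
  show "(\<lambda>n. quartic_fourier a b q (u n)) \<longlonglongrightarrow> quartic_fourier a b q y"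
    unfolding quartic_fourier_def
  proof (rule integral_dominated_convergence[where w = "\<lambda>s. exp 1 * (\<bar>s\<bar> ^ q * exp (- (r * s)\<^sup>2 / 2))"])
    show "integrable lborel (\<lambda>s. exp 1 * (\<bar>s\<bar> ^ q * exp (- (r * s)\<^sup>2 / 2)))"
      using assms by (intro integrable_mult_right gauss_moment_scaled) (simp add: scaled_def)
    show "AE s in lborel. (\<lambda>n. complex_of_real (s ^ q * exp (- (a * s\<^sup>2 + b * s ^ 4))) * exp (\<i> * complex_of_real (s * u n)))
       \<longlonglongrightarrow> complex_of_real (s ^ q * exp (- (a * s\<^sup>2 + b * s ^ 4))) * exp (\<i> * complex_of_real (s * y))"
      by (intro AE_I2 tendsto_intros u)
  qed (use quartic_fourier_integrand_bound[OF assms] in auto)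
qed


section \<open>The heat kernel of the anisotropic operator\<close>

text \<open>The heat kernel with multiplier \<open>\<xi>\<^sup>q\<close> is of size \<open>t powr - decay e q\<close> for \<open>t \<le> 1\<close>, because \<open>\<xi>\<^sub>e\<close> scales
  like \<open>t powr - (1 / 4)\<close> and the other frequencies like \<open>t powr - (1 / 2)\<close>. For \<open>t > 1\<close> all frequencies
  scale like \<open>t powr - (1 / 2)\<close>, which gives \<open>late_decay\<close>.\<close>

definition decay :: "'n::finite \<Rightarrow> ('n \<Rightarrow> nat) \<Rightarrow> real" where
  "decay e q = (\<Sum>j\<in>UNIV. (if j = e then 1 / 4 else 1 / 2) * real (q j + 1))"

definition late_decay :: "('n::finite \<Rightarrow> nat) \<Rightarrow> real" where
  "late_decay q = (\<Sum>j\<in>UNIV. 1 / 2 * real (q j + 1))"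

definition quartic_coeff :: "'n \<Rightarrow> real \<Rightarrow> 'n \<Rightarrow> real" where
  "quartic_coeff e t j = (if j = e then t else 0)"

text \<open>The inverse Fourier transform of \<open>\<xi>\<^sup>q exp (- t (\<bar>\<xi>\<bar>\<^sup>2 + \<xi>\<^sub>e\<^sup>4))\<close>, see \<open>heat_symbol_cofourier\<close> below. It is
  defined as a product over the coordinates, since the exponent has separated variables.\<close>

definition heat :: "'n::finite \<Rightarrow> ('n \<Rightarrow> nat) \<Rightarrow> real \<Rightarrow> real^'n \<Rightarrow> complex" where
  "heat e q t x = (\<Prod>j\<in>UNIV. complex_of_real (1 / (2 * pi)) * quartic_fourier t (quartic_coeff e t j) (q j) (x $ j))"

definition weight :: "'n::finite \<Rightarrow> real^'n \<Rightarrow> real" where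
  "weight e x = (x $ e)\<^sup>2 + perp_norm e x"

text \<open>The length scale of the factor \<open>j\<close> of the heat kernel, in the sense of \<open>scaled\<close>.\<close>

definition radius :: "'n \<Rightarrow> real \<Rightarrow> 'n \<Rightarrow> real" where
  "radius e t j = t powr (if j = e \<and> t \<le> 1 then 1 / 4 else 1 / 2)"

lemma powr_power': "(t powr a) ^ n = t powr (a * real n)" if "t > 0" for t a :: real
  using that by (simp add: powr_powr flip: powr_realpow)

lemma scaled_radius:
  assumes "t > 0"
  shows "scaled (radius e t j) t (quartic_coeff e t j)"
proof -
  have le: "t \<le> t powr (1 / 2)" if "t \<le> 1"
    using assms that powr_mono'[of "1 / 2" 1 t] by simp
  have ge: "t \<le> t powr 2" if "t > 1"
    using that powr_mono[of 1 2 t] by simp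
  show ?thesis
    unfolding scaled_def radius_def powr_power'[OF assms]
    using assms le ge by (auto simp: quartic_coeff_def)
qed

lemma prod_radius:
  assumes "t > 0"
  shows "(\<Prod>j\<in>UNIV. inverse (radius e t j ^ (q j + 1))) = t powr - (if t \<le> 1 then decay e q else late_decay q)"
proof -
  have "(\<Prod>j\<in>UNIV. inverse (radius e t j ^ (q j + 1)))
     = (\<Prod>j\<in>UNIV. t powr - ((if j = e \<and> t \<le> 1 then 1 / 4 else 1 / 2) * real (q j + 1)))"
    unfolding radius_def powr_power'[OF assms] powr_minus ..
  also have "\<dots> = t powr - (\<Sum>j\<in>UNIV. (if j = e \<and> t \<le> 1 then 1 / 4 else 1 / 2) * real (q j + 1))"
    unfolding sum_negf[symmetric] by (rule powr_sum[symmetric]) (use assms in auto)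
  finally show ?thesis by (simp add: decay_def late_decay_def)
qed

text \<open>The decay in one coordinate is taken from the corresponding factor; the other factors
  contribute only their size.\<close>

lemma heat_coordinate_bound:
  "\<exists>C\<ge>0. \<forall>t x i. 0 < t \<longrightarrow> \<bar>x $ i\<bar> ^ M * norm (heat e q t x)
     \<le> C * radius e t i ^ M * t powr - (if t \<le> 1 then decay e q else late_decay q)"
proof -
  have "\<exists>C\<ge>0. \<forall>r a b y. scaled r a b \<longrightarrow> \<bar>y\<bar> ^ K * norm (quartic_fourier a b p y) * r ^ (p + 1) \<le> C * r ^ K" for K p
    by (rule quartic_fourier_bound)
  then obtain C where C: "\<And>K p. C K p \<ge> 0"
    "\<And>K p r a b y. scaled r a b \<Longrightarrow> \<bar>y\<bar> ^ K * norm (quartic_fourier a b p y) * r ^ (p + 1) \<le> C K p * r ^ K"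
    by metis
  define D where "D j = C 0 (q j) + C M (q j)" for j
  have D: "D j \<ge> 0" for j using C(1) by (simp add: D_def)
  show ?thesis
  proof (intro exI[of _ "\<Prod>j\<in>UNIV. D j"] conjI allI impI)
    show "0 \<le> (\<Prod>j\<in>UNIV. D j)" by (intro prod_nonneg) (use D in auto)
    fix t :: real and x :: "real^'a" and i :: 'a assume t: "0 < t"
    let ?r = "radius e t"
    let ?n = "\<lambda>j. norm (quartic_fourier t (quartic_coeff e t j) (q j) (x $ j))"
    have r: "?r j > 0" for j using t by (simp add: radius_def)
    have n0: "?n j \<le> D j * inverse (?r j ^ (q j + 1))" for j
    proof -
      have "?n j * ?r j ^ (q j + 1) \<le> D j"
        using C(2)[OF scaled_radius[OF t], of "x $ j" 0 e j "q j"] C(1)[of M "q j"] by (simp add: D_def)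
      then show ?thesis using r[of j] by (simp add: field_simps)
    qed
    have nM: "\<bar>x $ j\<bar> ^ M * ?n j \<le> ?r j ^ M * (D j * inverse (?r j ^ (q j + 1)))" for j
    proof -
      have "\<bar>x $ j\<bar> ^ M * ?n j * ?r j ^ (q j + 1) \<le> C M (q j) * ?r j ^ M"
        by (rule C(2)[OF scaled_radius[OF t]])
      also have "\<dots> \<le> D j * ?r j ^ M"
        using C(1)[of 0 "q j"] r[of j] by (intro mult_right_mono) (auto simp: D_def)
      finally show ?thesis using r[of j] by (simp add: field_simps)
    qed
    have "norm (heat e q t x) = (\<Prod>j\<in>UNIV. 1 / (2 * pi) * ?n j)"
      unfolding heat_def prod_norm[symmetric] norm_mult norm_of_real by simp
    also have "\<dots> \<le> (\<Prod>j\<in>UNIV. ?n j)"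
    proof (intro prod_mono conjI)
      fix j
      have "1 / (2 * pi) * ?n j \<le> 1 * ?n j"
        by (intro mult_right_mono) (use pi_gt3 in auto)
      then show "1 / (2 * pi) * ?n j \<le> ?n j" by simp
    qed simp
    finally have "\<bar>x $ i\<bar> ^ M * norm (heat e q t x) \<le> \<bar>x $ i\<bar> ^ M * (\<Prod>j\<in>UNIV. ?n j)"
      by (rule mult_left_mono) simp
    also have "\<dots> = (\<Prod>j\<in>UNIV. (if j = i then \<bar>x $ j\<bar> ^ M else 1) * ?n j)"
      by (simp add: prod.distrib)
    also have "\<dots> \<le> (\<Prod>j\<in>UNIV. (if j = i then ?r j ^ M else 1) * (D j * inverse (?r j ^ (q j + 1))))"
      by (intro prod_mono conjI) (use n0 nM in auto)
    also have "\<dots> = (\<Prod>j\<in>UNIV. D j) * ?r i ^ M * (\<Prod>j\<in>UNIV. inverse (?r j ^ (q j + 1)))"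
      by (simp only: prod.distrib prod.delta finite_class.finite_UNIV iso_tuple_UNIV_I if_True mult_ac)
    finally show "\<bar>x $ i\<bar> ^ M * norm (heat e q t x) \<le> (\<Prod>j\<in>UNIV. D j) * ?r i ^ M
       * t powr - (if t \<le> 1 then decay e q else late_decay q)"
      unfolding prod_radius[OF t] .
  qed
qed

lemma perp_norm_nonneg: "0 \<le> perp_norm e x"
  by (simp add: perp_norm_def sum_nonneg)

lemma weight_nonneg: "0 \<le> weight e x"
  by (simp add: weight_def perp_norm_nonneg)

lemma norm_sq_perp: "(norm x)\<^sup>2 = (x $ e)\<^sup>2 + (perp_norm e x)\<^sup>2"
  by (simp add: norm_sq_vec perp_norm_def sum_nonneg sum.remove[of UNIV e])

lemma weight_pos: "x \<noteq> 0 \<Longrightarrow> 0 < weight e x"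
proof -
  assume "x \<noteq> 0"
  then have "0 < (x $ e)\<^sup>2 + (perp_norm e x)\<^sup>2" by (simp flip: norm_sq_perp)
  then have "x $ e \<noteq> 0 \<or> perp_norm e x \<noteq> 0" by auto
  then show ?thesis
    using perp_norm_nonneg[of e x] by (auto simp: weight_def add_pos_nonneg add_nonneg_pos)
qed

lemma weight_continuous: "continuous_on A (weight e)"
  unfolding weight_def perp_norm_def by (intro continuous_intros)

text \<open>Decay in the weight thus follows from decay in a single coordinate, with twice the power for \<open>e\<close>.\<close>

lemma weight_le_coordinate:
  fixes x :: "real^'n::finite"
  obtains i where "weight e x \<le> real CARD('n) * (if i = e then \<bar>x $ i\<bar>\<^sup>2 else \<bar>x $ i\<bar>)"
proof -
  let ?w = "\<lambda>i. if i = e then \<bar>x $ i\<bar>\<^sup>2 else \<bar>x $ i\<bar>"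
  have "perp_norm e x \<le> (\<Sum>j\<in>UNIV - {e}. \<bar>x $ j\<bar>)"
    unfolding perp_norm_def using L2_set_le_sum_abs[of "\<lambda>j. x $ j" "UNIV - {e}"] by (simp add: L2_set_def)
  also have "\<dots> = (\<Sum>j\<in>UNIV - {e}. ?w j)" by (rule sum.cong) auto
  finally have "weight e x \<le> (\<Sum>j\<in>UNIV. ?w j)"
    by (simp add: weight_def sum.remove[of UNIV e])
  also have "\<dots> \<le> real CARD('n) * Max (range ?w)"
    using sum_bounded_above[of UNIV ?w "Max (range ?w)"] by simp
  finally have "weight e x \<le> real CARD('n) * Max (range ?w)" .
  moreover have "Max (range ?w) \<in> range ?w" by (rule Max_in) auto
  ultimately show thesis using that by (metis (no_types, lifting) imageE)
qed

text \<open>The weight \<open>x\<^sub>e\<^sup>2 + \<bar>x\<^sub>\<perp>\<bar>\<close> scales like \<open>sqrt t\<close>, since \<open>x\<^sub>e\<close> has the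
  scale \<open>t powr (1 / 4)\<close> and the other coordinates have the scale \<open>t powr (1 / 2)\<close>.\<close>

lemma heat_weight_bound:
  "\<exists>C\<ge>0. \<forall>t x. 0 < t \<and> t \<le> 1 \<longrightarrow> weight e x ^ M * norm (heat e q t x) \<le> C * t powr (real M / 2 - decay e q)"
proof -
  obtain C1 where C1: "C1 \<ge> 0" "\<And>t x i. 0 < t \<Longrightarrow> \<bar>x $ i\<bar> ^ M * norm (heat e q t x)
     \<le> C1 * radius e t i ^ M * t powr - (if t \<le> 1 then decay e q else late_decay q)"
    using heat_coordinate_bound[where M = M and e = e and q = q] by metis
  obtain C2 where C2: "C2 \<ge> 0" "\<And>t x i. 0 < t \<Longrightarrow> \<bar>x $ i\<bar> ^ (2 * M) * norm (heat e q t x)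
     \<le> C2 * radius e t i ^ (2 * M) * t powr - (if t \<le> 1 then decay e q else late_decay q)"
    using heat_coordinate_bound[where M = "2 * M" and e = e and q = q] by metis
  let ?N = "real CARD('a)"
  show ?thesis
  proof (intro exI[of _ "?N ^ M * (C1 + C2)"] conjI allI impI)
    fix t :: real and x :: "real^'a" assume t: "0 < t \<and> t \<le> 1"
    obtain i where i: "weight e x \<le> ?N * (if i = e then \<bar>x $ i\<bar>\<^sup>2 else \<bar>x $ i\<bar>)" (is "_ \<le> _ * ?w")
      by (rule weight_le_coordinate)
    have rad: "radius e t i ^ (if i = e then 2 * M else M) = t powr (real M / 2)"
      using t by (auto simp: radius_def powr_power')
    have "?w ^ M * norm (heat e q t x) = \<bar>x $ i\<bar> ^ (if i = e then 2 * M else M) * norm (heat e q t x)"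
      by (simp add: power_mult)
    also have "\<dots> \<le> (C1 + C2) * radius e t i ^ (if i = e then 2 * M else M) * t powr - decay e q"
    proof (cases "i = e")
      case True
      have "\<bar>x $ i\<bar> ^ (2 * M) * norm (heat e q t x) \<le> C2 * radius e t i ^ (2 * M) * t powr - decay e q"
        using C2(2)[of t x i] t by simp
      also have "\<dots> \<le> (C1 + C2) * radius e t i ^ (2 * M) * t powr - decay e q"
        using C1(1) by (intro mult_right_mono) (auto simp: radius_def)
      finally show ?thesis using True by simp
    next
      case False
      have "\<bar>x $ i\<bar> ^ M * norm (heat e q t x) \<le> C1 * radius e t i ^ M * t powr - decay e q"
        using C1(2)[of t x i] t by simp
      also have "\<dots> \<le> (C1 + C2) * radius e t i ^ M * t powr - decay e q"
        using C2(1) by (intro mult_right_mono) (auto simp: radius_def)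
      finally show ?thesis using False by simp
    qed
    also have "\<dots> = (C1 + C2) * t powr (real M / 2 - decay e q)"
      unfolding rad by (simp only: diff_conv_add_uminus powr_add mult.assoc)
    finally have *: "?w ^ M * norm (heat e q t x) \<le> (C1 + C2) * t powr (real M / 2 - decay e q)" .
    have "weight e x ^ M * norm (heat e q t x) \<le> (?N * ?w) ^ M * norm (heat e q t x)"
      by (intro mult_right_mono power_mono i weight_nonneg) simp
    also have "\<dots> = ?N ^ M * (?w ^ M * norm (heat e q t x))" by (simp only: power_mult_distrib mult.assoc)
    also have "\<dots> \<le> ?N ^ M * ((C1 + C2) * t powr (real M / 2 - decay e q))"
      by (intro mult_left_mono *) simp
    finally show "weight e x ^ M * norm (heat e q t x) \<le> ?N ^ M * (C1 + C2) * t powr (real M / 2 - decay e q)"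
      by (simp only: mult.assoc)
  qed (use C1 C2 in auto)
qed

lemma heat_late_bound:
  "\<exists>C\<ge>0. \<forall>t x. 1 < t \<longrightarrow> norm (heat e q t x) \<le> C * t powr - late_decay q"
proof -
  obtain C1 where C1: "C1 \<ge> 0" "\<And>t x i. 0 < t \<Longrightarrow> \<bar>x $ i\<bar> ^ 0 * norm (heat e q t x)
     \<le> C1 * radius e t i ^ 0 * t powr - (if t \<le> 1 then decay e q else late_decay q)"
    using heat_coordinate_bound[where M = 0 and e = e and q = q] by metis
  have "norm (heat e q t x) \<le> C1 * t powr - late_decay q" if "1 < t" for t x
    using C1(2)[of t x e] that by simp
  with C1(1) show ?thesis by blast
qed

lemma quartic_fourier_measurable [measurable]:
  assumes [measurable]: "f \<in> borel_measurable M" "g \<in> borel_measurable M" "h \<in> borel_measurable M"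
  shows "(\<lambda>z. quartic_fourier (f z) (g z) q (h z)) \<in> borel_measurable M"
  unfolding quartic_fourier_def by measurable

lemma heat_measurable [measurable]:
  assumes [measurable]: "f \<in> borel_measurable M" "g \<in> borel_measurable M"
  shows "(\<lambda>z. heat e q (f z) (g z)) \<in> borel_measurable M"
proof -
  have [measurable]: "(\<lambda>z. g z $ j) \<in> borel_measurable M" for j
    by (rule measurable_compose[OF assms(2)]) simp
  have [measurable]: "(\<lambda>z. quartic_coeff e (f z) j) \<in> borel_measurable M" for j
    by (cases "j = e") (simp_all add: quartic_coeff_def)
  show ?thesis unfolding heat_def by measurable
qed

lemma heat_continuous:
  assumes "t > 0"
  shows "continuous_on UNIV (heat e q t)"
  unfolding heat_def
  by (intro continuous_intros continuous_on_compose2[OF quartic_fourier_continuous[OF scaled_radius[OF assms]]]) auto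


section \<open>The kernel as a superposition of heat kernels\<close>

lemma has_bochner_integral_FTC_atLeast:
  fixes f F :: "real \<Rightarrow> real"
  assumes meas: "f \<in> borel_measurable borel"
    and F: "\<And>x. a \<le> x \<Longrightarrow> DERIV F x :> f x"
    and nonneg: "\<And>x. a \<le> x \<Longrightarrow> 0 \<le> f x"
    and lim: "(F \<longlongrightarrow> T) at_top"
  shows "has_bochner_integral lborel (\<lambda>x. indicator {a..} x * f x) (T - F a)"
proof (rule has_bochner_integral_nn_integral)
  show "(\<lambda>x. indicator {a..} x * f x) \<in> borel_measurable lborel" using meas by measurable
  show "AE x in lborel. 0 \<le> indicator {a..} x * f x"
    using nonneg by (auto simp: indicator_def)
  have "F a \<le> F x" if "a \<le> x" for x
    by (rule DERIV_nonneg_imp_nondecreasing[OF that]) (use F nonneg in blast)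
  then have "\<forall>\<^sub>F x in at_top. F a \<le> F x"
    using eventually_ge_at_top[of a] by (rule eventually_mono[rotated])
  then show "0 \<le> T - F a" using tendsto_lowerbound[OF lim] by simp
  have "(\<integral>\<^sup>+x. ennreal (indicator {a..} x * f x) \<partial>lborel) = (\<integral>\<^sup>+x. ennreal (f x) * indicator {a..} x \<partial>lborel)"
    by (rule nn_integral_cong) (auto simp: indicator_def)
  then show "(\<integral>\<^sup>+x. ennreal (indicator {a..} x * f x) \<partial>lborel) = ennreal (T - F a)"
    using nn_integral_FTC_atLeast[OF meas F nonneg lim] by simp
qed

lemma has_bochner_integral_powr_tail:
  fixes a p :: real
  assumes "a > 0" "p > 1"
  shows "has_bochner_integral lborel (\<lambda>t. indicator {a..} t * t powr - p) (a powr (1 - p) / (p - 1))"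
proof -
  have "has_bochner_integral lborel (\<lambda>t. indicator {a..} t * t powr - p) (0 - - (a powr (1 - p) / (p - 1)))"
  proof (rule has_bochner_integral_FTC_atLeast[where F = "\<lambda>t. - (t powr (1 - p) / (p - 1))"])
    fix t :: real assume "a \<le> t"
    then have "t > 0" using assms by simp
    then show "((\<lambda>t. - (t powr (1 - p) / (p - 1))) has_real_derivative t powr - p) (at t)"
    proof -
      have "((\<lambda>t. - (t powr (1 - p) / (p - 1))) has_real_derivative - ((1 - p) * t powr (1 - p - 1) / (p - 1))) (at t)"
        by (intro DERIV_minus DERIV_cdivide has_real_derivative_powr \<open>t > 0\<close>)
      moreover have "- ((1 - p) * t powr (1 - p - 1) / (p - 1)) = t powr - p"
        using assms by (simp add: divide_simps) (simp add: algebra_simps)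
      ultimately show ?thesis by simp
    qed
    show "0 \<le> t powr - p" by simp
  next
    have "((\<lambda>t::real. t powr (1 - p)) \<longlongrightarrow> 0) at_top"
      using tendsto_neg_powr[OF _ filterlim_ident, of "1 - p"] assms by simp
    then have "((\<lambda>t. - (t powr (1 - p) / (p - 1))) \<longlongrightarrow> - (0 / (p - 1))) at_top"
      by (intro tendsto_intros) (use assms in auto)
    then show "((\<lambda>t. - (t powr (1 - p) / (p - 1))) \<longlongrightarrow> 0) at_top" by simp
  qed measurable
  then show ?thesis by simp
qed

lemma has_bochner_integral_exp:
  fixes Q :: real
  assumes "Q > 0"
  shows "has_bochner_integral lborel (\<lambda>t. indicator {0<..} t * exp (- (t * Q))) (1 / Q)"
proof -
  have "has_bochner_integral lborel (\<lambda>t. indicator {0..} t * exp (- (t * Q))) (0 - - (exp (- (0 * Q)) / Q))"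
  proof (rule has_bochner_integral_FTC_atLeast[where F = "\<lambda>t. - (exp (- (t * Q)) / Q)"])
    show "((\<lambda>t. - (exp (- (t * Q)) / Q)) has_real_derivative exp (- (t * Q))) (at t)" for t
      using assms by (auto intro!: derivative_eq_intros)
    have "filterlim (\<lambda>t. Q * t) at_top at_top"
      by (rule filterlim_tendsto_pos_mult_at_top[OF tendsto_const assms filterlim_ident])
    then have "filterlim (\<lambda>t. - (t * Q)) at_bot at_top"
      by (simp add: filterlim_uminus_at_top mult.commute)
    then have "((\<lambda>t. exp (- (t * Q))) \<longlongrightarrow> 0) at_top"
      by (rule filterlim_compose[OF exp_at_bot])
    then have "((\<lambda>t. - (exp (- (t * Q)) / Q)) \<longlongrightarrow> - (0 / Q)) at_top"
      by (intro tendsto_intros) (use assms in auto)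
    then show "((\<lambda>t. - (exp (- (t * Q)) / Q)) \<longlongrightarrow> 0) at_top" by simp
  qed auto
  then have closed: "has_bochner_integral lborel (\<lambda>t. indicator {0..} t * exp (- (t * Q))) (1 / Q)" by simp
  have ae: "AE t in lborel. indicator {0..} t * exp (- (t * Q)) = indicator {0<..} t * exp (- (t * Q))"
    using AE_lborel_singleton[of "0::real"] by eventually_elim (auto simp: indicator_def)
  have meas: "(\<lambda>t::real. indicator {0..} t * exp (- (t * Q))) \<in> borel_measurable lborel"
    "(\<lambda>t::real. indicator {0<..} t * exp (- (t * Q))) \<in> borel_measurable lborel" by measurable
  show ?thesis using has_bochner_integral_cong_AE[OF meas ae] closed by blast
qed

definition kernel :: "'n::finite \<Rightarrow> ('n \<Rightarrow> nat) \<Rightarrow> real^'n \<Rightarrow> complex" where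
  "kernel e q x = (LINT t|lborel. indicator {0<..} t *\<^sub>R heat e q t x)"

text \<open>Away from the origin the heat kernels are bounded for \<open>t \<le> 1\<close>, by a high power of
  the weight, and integrable for \<open>t > 1\<close>. The majorant is uniform in \<open>x\<close> and serves both the continuity
  of the kernel and the exchange of integrals.\<close>

lemma heat_dominated:
  assumes "late_decay q > 1" "c > 0"
  obtains w where "integrable lborel w" "\<And>t. 0 \<le> w t"
    "\<And>t x. c \<le> weight e x \<Longrightarrow> norm (indicator {0<..} t *\<^sub>R heat e q t x) \<le> w t"
proof -
  \<comment> \<open>Large enough to make the power of \<open>t\<close> in \<open>heat_weight_bound\<close> nonnegative.\<close>
  define M where "M = nat \<lceil>2 * decay e q\<rceil>"
  have M: "0 \<le> real M / 2 - decay e q" unfolding M_def by linarith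
  obtain C1 where C1: "C1 \<ge> 0" "\<And>t x. 0 < t \<Longrightarrow> t \<le> 1 \<Longrightarrow>
      weight e x ^ M * norm (heat e q t x) \<le> C1 * t powr (real M / 2 - decay e q)"
    using heat_weight_bound[where M = M and e = e and q = q] by blast
  obtain C2 where C2: "C2 \<ge> 0" "\<And>t x. 1 < t \<Longrightarrow> norm (heat e q t x) \<le> C2 * t powr - late_decay q"
    using heat_late_bound[of e q] by blast
  let ?w = "\<lambda>t. C1 / c ^ M * indicator {0..1} t + C2 * (indicator {1..} t * t powr - late_decay q)"
  show thesis
  proof (rule that[of ?w])
    show "integrable lborel ?w"
    proof (intro Bochner_Integration.integrable_add integrable_mult_right)
      show "integrable lborel (\<lambda>t::real. indicator {0..1} t :: real)"
        by (simp add: integrable_indicator_iff)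
      show "integrable lborel (\<lambda>t::real. indicator {1..} t * t powr - late_decay q)"
        using has_bochner_integral_powr_tail[OF _ assms(1), of 1] by (auto simp: has_bochner_integral_iff)
    qed
    show "0 \<le> ?w t" for t using C1 C2 assms by simp
    fix t :: real and x assume x: "c \<le> weight e x"
    consider "t \<le> 0" | "0 < t" "t \<le> 1" | "1 < t" by linarith
    then show "norm (indicator {0<..} t *\<^sub>R heat e q t x) \<le> ?w t"
    proof cases
      case 1
      then show ?thesis using C1 C2 assms by simp
    next
      case 2
      have "c ^ M * norm (heat e q t x) \<le> weight e x ^ M * norm (heat e q t x)"
        using x assms by (intro mult_right_mono power_mono) auto
      also have "\<dots> \<le> C1 * t powr (real M / 2 - decay e q)" by (rule C1(2)[OF 2])
      also have "\<dots> \<le> C1 * 1"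
        using 2 M C1(1) by (intro mult_left_mono powr_le1) auto
      finally have "norm (heat e q t x) \<le> C1 / c ^ M" using assms by (simp add: field_simps)
      then show ?thesis using 2 C2 by (simp add: indicator_def add_increasing2)
    next
      case 3
      then show ?thesis using C2(2)[OF 3, of x] by (simp add: indicator_def)
    qed
  qed
qed

lemma kernel_continuous:
  fixes e :: "'n::finite"
  assumes "late_decay q > 1"
  shows "continuous_on (- {0}) (kernel e q)"
proof (rule continuous_at_imp_continuous_on, rule ballI)
  fix x :: "real^'n" assume "x \<in> - {0}"
  then have pos: "0 < weight e x" by (simp add: weight_pos)
  let ?U = "{y. weight e x / 2 < weight e y}"
  have U: "open ?U" "x \<in> ?U"
    using pos by (auto intro!: open_Collect_less continuous_intros weight_continuous)
  obtain w where w: "integrable lborel w"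
    "\<And>t y. weight e x / 2 \<le> weight e y \<Longrightarrow> norm (indicator {0<..} t *\<^sub>R heat e q t y) \<le> w t"
    using heat_dominated[OF assms, of "weight e x / 2" e] pos by (metis half_gt_zero)
  have "continuous_on ?U (kernel e q)"
  proof (rule continuous_on_sequentiallyI)
    fix u y assume u: "\<forall>n. u n \<in> ?U" "y \<in> ?U" "u \<longlonglongrightarrow> y"
    show "(\<lambda>n. kernel e q (u n)) \<longlonglongrightarrow> kernel e q y"
      unfolding kernel_def
    proof (rule integral_dominated_convergence[where w = w])
      show "AE t in lborel. (\<lambda>n. indicator {0<..} t *\<^sub>R heat e q t (u n)) \<longlonglongrightarrow> indicator {0<..} t *\<^sub>R heat e q t y"
      proof (rule AE_I2)
        fix t :: real
        show "(\<lambda>n. indicator {0<..} t *\<^sub>R heat e q t (u n)) \<longlonglongrightarrow> indicator {0<..} t *\<^sub>R heat e q t y"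
        proof (cases "0 < t")
          case True
          then have "(\<lambda>n. heat e q t (u n)) \<longlonglongrightarrow> heat e q t y"
            by (intro continuous_on_tendsto_compose[OF heat_continuous u(3)]) auto
          then show ?thesis by (intro tendsto_intros)
        qed simp
      qed
      show "AE t in lborel. norm (indicator {0<..} t *\<^sub>R heat e q t (u n)) \<le> w t" for n
        using w(2)[of "u n"] u(1) by (intro AE_I2) (auto simp: less_imp_le)
    qed (use w in auto)
  qed
  then show "isCont (kernel e q) x"
    using U continuous_on_eq_continuous_at by blast
qed

text \<open>The integral over intermediate times is the only source of a logarithm, which comes from \<open>d = 1\<close>.\<close>

lemma middle_integral:
  fixes R d :: real
  assumes R: "0 < R" "R \<le> 1" and d: "1 \<le> d"
  obtains I where "has_bochner_integral lborel (\<lambda>t. indicator {R\<^sup>2..1} t * t powr - d) I"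
    "R powr (2 * d - 2) * I \<le> (if d = 1 then 2 * \<bar>ln R\<bar> else 1 / (d - 1))"
proof (cases "d = 1")
  case True
  have R2: "R\<^sup>2 \<le> 1" using R by (simp add: power_le_one)
  have "has_bochner_integral lborel (\<lambda>t. (1 / t) * indicator {R\<^sup>2..1} t) (ln 1 - ln (R\<^sup>2))"
  proof (rule has_bochner_integral_FTC_Icc_real[OF R2])
    fix t assume "R\<^sup>2 \<le> t" "t \<le> 1"
    moreover have "0 < R\<^sup>2" using R by simp
    ultimately have "0 < t" by linarith
    then show "(ln has_real_derivative 1 / t) (at t)" "isCont (\<lambda>t. 1 / t) t"
      by (auto intro!: derivative_eq_intros continuous_intros)
  qed
  also have "(\<lambda>t. (1 / t) * indicator {R\<^sup>2..1} t) = (\<lambda>t. indicator {R\<^sup>2..1} t * t powr - d)"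
  proof
    fix t
    have "0 < R\<^sup>2" using R by simp
    then have "0 < t" if "R\<^sup>2 \<le> t" using that by (rule less_le_trans)
    then show "(1 / t) * indicator {R\<^sup>2..1} t = indicator {R\<^sup>2..1} t * t powr - d"
      using True by (cases "R\<^sup>2 \<le> t") (auto simp: indicator_def powr_minus_divide)
  qed
  finally show thesis
    using R True by (intro that) (auto simp: ln_realpow)
next
  case False
  then have d1: "1 < d" using d by simp
  have R2: "0 < R\<^sup>2" using R by simp
  note tail = has_bochner_integral_powr_tail[OF R2 d1]
  have int: "integrable lborel (\<lambda>t. indicator {R\<^sup>2..1} t * t powr - d)"
    by (rule Bochner_Integration.integrable_bound[OF tail[THEN has_bochner_integral_iff[THEN iffD1], THEN conjunct1]])
       (auto simp: indicator_def)
  have "(LINT t|lborel. indicator {R\<^sup>2..1} t * t powr - d) \<le> (LINT t|lborel. indicator {R\<^sup>2..} t * t powr - d)"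
    using tail int by (intro integral_mono) (auto simp: has_bochner_integral_iff indicator_def)
  also have "\<dots> = (R\<^sup>2) powr (1 - d) / (d - 1)" using tail by (simp add: has_bochner_integral_iff)
  finally have "R powr (2 * d - 2) * (LINT t|lborel. indicator {R\<^sup>2..1} t * t powr - d)
      \<le> R powr (2 * d - 2) * ((R\<^sup>2) powr (1 - d) / (d - 1))"
    by (rule mult_left_mono) simp
  also have "(R\<^sup>2) powr (1 - d) = R powr (2 * (1 - d))" using R by (simp add: powr_powr flip: powr_numeral)
  also have "R powr (2 * d - 2) * (R powr (2 * (1 - d)) / (d - 1)) = 1 / (d - 1)"
    using R by (simp add: powr_add[symmetric] algebra_simps)
  finally show thesis
    using False has_bochner_integral_integrable[OF int] by (intro that) auto
qed

text \<open>Write \<open>\<rho>\<close> for the weight of \<open>x\<close> and \<open>d\<close> for \<open>decay e q\<close>, and split the integral over \<open>t\<close> at \<open>\<rho>\<^sup>2\<close> and \<open>1\<close>.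
  Below \<open>\<rho>\<^sup>2\<close> the rapid decay bounds the heat kernel by a multiple of \<open>\<rho> powr (- 2 * d)\<close>; between \<open>\<rho>\<^sup>2\<close> and
  \<open>1\<close> its size \<open>t powr - d\<close> is integrated. Both contributions are of order \<open>\<rho> powr (2 - 2 * d)\<close>, with a
  logarithm in the second one if \<open>d = 1\<close>. The times beyond \<open>1\<close> contribute a bounded term.\<close>

lemma kernel_bound:
  fixes e :: "'n::finite"
  assumes d: "1 \<le> decay e q" and l: "1 < late_decay q"
  shows "\<exists>C\<ge>0. \<forall>x. 0 < weight e x \<and> weight e x \<le> 2 \<longrightarrow>
    weight e x powr (2 * decay e q - 2) * norm (kernel e q x)
      \<le> C * (1 + of_bool (decay e q = 1) * \<bar>ln (weight e x)\<bar>)"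
proof -
  let ?d = "decay e q" and ?l = "late_decay q"
  define M where "M = nat \<lceil>2 * ?d\<rceil>"
  have M: "0 \<le> real M / 2 - ?d" unfolding M_def by linarith
  obtain C1 where C1: "C1 \<ge> 0" "\<And>t x. 0 < t \<Longrightarrow> t \<le> 1 \<Longrightarrow>
      weight e x ^ M * norm (heat e q t x) \<le> C1 * t powr (real M / 2 - ?d)"
    using heat_weight_bound[where M = M and e = e and q = q] by blast
  obtain C0 where C0: "C0 \<ge> 0" "\<And>t x. 0 < t \<Longrightarrow> t \<le> 1 \<Longrightarrow> norm (heat e q t x) \<le> C0 * t powr - ?d"
    using heat_weight_bound[where M = 0 and e = e and q = q] by auto
  obtain C2 where C2: "C2 \<ge> 0" "\<And>t x. 1 < t \<Longrightarrow> norm (heat e q t x) \<le> C2 * t powr - ?l"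
    using heat_late_bound[of e q] by blast
  define K where "K = C0 + C1 + C2"
  have K: "K \<ge> 0" "C0 \<le> K" "C1 \<le> K" "C2 \<le> K" using C0 C1 C2 by (auto simp: K_def)
  define B where "B = (if ?d = 1 then 2 else 1 / (?d - 1))"
  have B: "B \<ge> 0" using d by (simp add: B_def)
  let ?C = "2 powr (2 * ?d - 2) * (K * (1 + B + 1 / (?l - 1)))"
  show ?thesis
  proof (intro exI[of _ ?C] conjI allI impI)
    show "0 \<le> ?C" using K B l by simp
    fix x :: "real^'n" assume x: "0 < weight e x \<and> weight e x \<le> 2"
    \<comment> \<open>The weight may exceed \<open>1\<close>; truncating it costs at most the factor \<open>2\<close> and keeps \<open>R\<^sup>2 \<le> 1\<close>.\<close>
    define R where "R = min (weight e x) 1"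
    have R: "0 < R" "R \<le> 1" "R \<le> weight e x" "weight e x \<le> 2 * R" using x by (auto simp: R_def)
    have R2: "0 < R\<^sup>2" "R\<^sup>2 \<le> 1" using R by (auto simp: power_le_one)
    obtain I where I: "has_bochner_integral lborel (\<lambda>t. indicator {R\<^sup>2..1} t * t powr - ?d) I"
      "R powr (2 * ?d - 2) * I \<le> (if ?d = 1 then 2 * \<bar>ln R\<bar> else 1 / (?d - 1))"
      by (rule middle_integral[OF R(1,2) d])
    let ?v = "\<lambda>t. K * (R powr (- 2 * ?d) * indicator {0..R\<^sup>2} t + indicator {R\<^sup>2..1} t * t powr - ?d + indicator {1..} t * t powr - ?l)"
    have "has_bochner_integral lborel (\<lambda>t::real. indicator {0..R\<^sup>2} t :: real) (R\<^sup>2)"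
      using has_bochner_integral_real_indicator[of "{0..R\<^sup>2}" lborel] R2 by simp
    then have v: "has_bochner_integral lborel ?v (K * (R powr (- 2 * ?d) * R\<^sup>2 + I + 1 powr (1 - ?l) / (?l - 1)))"
      by (intro has_bochner_integral_mult_right has_bochner_integral_add I has_bochner_integral_powr_tail l) simp_all
    have le: "norm (indicator {0<..} t *\<^sub>R heat e q t x) \<le> ?v t" for t
    proof -
      consider "t \<le> 0" | "0 < t" "t \<le> R\<^sup>2" | "R\<^sup>2 < t" "t \<le> 1" | "1 < t" by linarith
      then show ?thesis
      proof cases
        case 1
        then show ?thesis using K by simp
      next
        case 2
        have "R ^ M * norm (heat e q t x) \<le> weight e x ^ M * norm (heat e q t x)"
          using R by (intro mult_right_mono power_mono) auto
        also have "\<dots> \<le> C1 * t powr (real M / 2 - ?d)" using 2 R2 by (intro C1(2)) auto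
        also have "\<dots> \<le> K * (R\<^sup>2) powr (real M / 2 - ?d)"
          using 2 M K C1(1) by (intro mult_mono powr_mono2) auto
        also have "(R\<^sup>2) powr (real M / 2 - ?d) = R ^ M * R powr (- 2 * ?d)"
          using R by (simp add: powr_powr powr_add[symmetric] algebra_simps flip: powr_numeral powr_realpow)
        finally have "R ^ M * norm (heat e q t x) \<le> R ^ M * (K * R powr (- 2 * ?d))" by (simp add: mult_ac)
        then have "norm (heat e q t x) \<le> K * R powr (- 2 * ?d)" using R by simp
        also have "\<dots> \<le> ?v t" using 2 K by (intro mult_left_mono) (auto simp: indicator_def)
        finally show ?thesis using 2 by simp
      next
        case 3
        then have "0 < t" using R2 by linarith
        then have "norm (heat e q t x) \<le> C0 * t powr - ?d" using 3 by (intro C0(2))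
        also have "\<dots> \<le> K * t powr - ?d" using K by (intro mult_right_mono) auto
        also have "\<dots> \<le> ?v t" using 3 K by (intro mult_left_mono) (auto simp: indicator_def)
        finally show ?thesis using \<open>0 < t\<close> by (simp add: indicator_def)
      next
        case 4
        then have "norm (heat e q t x) \<le> C2 * t powr - ?l" by (rule C2(2))
        also have "\<dots> \<le> K * t powr - ?l" using K by (intro mult_right_mono) auto
        also have "\<dots> \<le> ?v t" using 4 K by (intro mult_left_mono) (auto simp: indicator_def)
        finally show ?thesis using 4 by (simp add: indicator_def)
      qed
    qed
    have "norm (kernel e q x) \<le> (LINT t|lborel. ?v t)"
      unfolding kernel_def
    proof (rule order_trans[OF integral_norm_bound integral_mono'])
      show "integrable lborel ?v" using v unfolding has_bochner_integral_iff by (rule conjunct1)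
      show "norm (indicator {0<..} t *\<^sub>R heat e q t x) \<le> ?v t" for t by (rule le)
      show "0 \<le> ?v t" for t using norm_ge_zero le[of t] by (rule order_trans)
    qed
    also have "\<dots> = K * (R powr (- 2 * ?d) * R\<^sup>2 + I + 1 / (?l - 1))"
      using v by (simp add: has_bochner_integral_iff)
    finally have kb: "norm (kernel e q x) \<le> K * (R powr (- 2 * ?d) * R\<^sup>2 + I + 1 / (?l - 1))" .
    have one: "R powr (2 * ?d - 2) * (R powr (- 2 * ?d) * R\<^sup>2) = 1"
      using R by (simp add: powr_add[symmetric] flip: powr_numeral)
    have small: "R powr (2 * ?d - 2) \<le> 1" using R d by (intro powr_le1) auto
    have lnR: "\<bar>ln R\<bar> \<le> \<bar>ln (weight e x)\<bar>" using x by (auto simp: R_def min_def)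
    let ?L = "1 + of_bool (?d = 1) * \<bar>ln (weight e x)\<bar>"
    have L: "1 \<le> ?L" by simp
    have mid: "R powr (2 * ?d - 2) * I \<le> B * ?L"
      using I(2) lnR by (auto simp: B_def algebra_simps)
    have "weight e x powr (2 * ?d - 2) \<le> (2 * R) powr (2 * ?d - 2)"
      using x R d by (intro powr_mono2) auto
    also have "\<dots> = 2 powr (2 * ?d - 2) * R powr (2 * ?d - 2)" using R by (simp add: powr_mult)
    finally have "weight e x powr (2 * ?d - 2) * norm (kernel e q x)
       \<le> (2 powr (2 * ?d - 2) * R powr (2 * ?d - 2)) * (K * (R powr (- 2 * ?d) * R\<^sup>2 + I + 1 / (?l - 1)))"
      by (intro mult_mono kb) auto
    also have "\<dots> = 2 powr (2 * ?d - 2) * (K * (R powr (2 * ?d - 2) * (R powr (- 2 * ?d) * R\<^sup>2)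
         + R powr (2 * ?d - 2) * I + R powr (2 * ?d - 2) * (1 / (?l - 1))))"
      by (simp only: distrib_left mult_ac)
    also have "\<dots> \<le> 2 powr (2 * ?d - 2) * (K * (1 * ?L + B * ?L + (1 / (?l - 1)) * ?L))"
    proof (intro mult_left_mono add_mono mid K)
      show "R powr (2 * ?d - 2) * (R powr (- 2 * ?d) * R\<^sup>2) \<le> 1 * ?L" unfolding one by simp
      have "R powr (2 * ?d - 2) * (1 / (?l - 1)) \<le> 1 * (1 / (?l - 1))"
        using small l by (intro mult_right_mono) auto
      also have "\<dots> \<le> (1 / (?l - 1)) * ?L" using l L mult_left_mono[OF L, of "1 / (?l - 1)"] by simp
      finally show "R powr (2 * ?d - 2) * (1 / (?l - 1)) \<le> (1 / (?l - 1)) * ?L" .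
    qed simp
    also have "\<dots> = ?C * ?L" by (simp only: distrib_right mult.assoc)
    finally show "weight e x powr (2 * ?d - 2) * norm (kernel e q x) \<le> ?C * ?L" .
  qed
qed

section \<open>Representation of the distribution by the kernel\<close>

definition monomial :: "('n::finite \<Rightarrow> nat) \<Rightarrow> real^'n \<Rightarrow> real" where
  "monomial q \<xi> = (\<Prod>j\<in>UNIV. (\<xi> $ j) ^ q j)"

definition elliptic :: "'n::finite \<Rightarrow> real^'n \<Rightarrow> real" where
  "elliptic e \<xi> = (norm \<xi>)\<^sup>2 + (\<xi> $ e) ^ 4"

lemma elliptic_pos: "\<xi> \<noteq> 0 \<Longrightarrow> 0 < elliptic e \<xi>"
  by (simp add: elliptic_def add_pos_nonneg)

text \<open>The symbol of the heat kernel is a product of functions of one coordinate.\<close>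

lemma
  fixes e :: "'n::finite"
  assumes t: "t > 0"
  shows heat_symbol_integrable:
      "integrable lborel (\<lambda>\<xi>::real^'n. complex_of_real (monomial q \<xi> * exp (- (t * elliptic e \<xi>))))"
    and heat_symbol_cofourier:
      "cofourier (\<lambda>\<xi>. complex_of_real (monomial q \<xi> * exp (- (t * elliptic e \<xi>)))) x
        = complex_of_real ((2 * pi) ^ CARD('n)) * heat e q t x"
proof -
  let ?s = "\<lambda>\<xi>::real^'n. complex_of_real (monomial q \<xi> * exp (- (t * elliptic e \<xi>)))"
  let ?f = "\<lambda>y j s. complex_of_real (s ^ q j * exp (- (t * s\<^sup>2 + quartic_coeff e t j * s ^ 4))) * exp (\<i> * complex_of_real (s * y $ j))"
  have Q: "t * elliptic e \<xi> = (\<Sum>j\<in>UNIV. t * (\<xi> $ j)\<^sup>2 + quartic_coeff e t j * (\<xi> $ j) ^ 4)" for \<xi>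
    by (simp add: elliptic_def norm_sq_vec quartic_coeff_def sum.distrib sum_distrib_left distrib_left
        if_distrib[of "\<lambda>x. x * _"] cong: if_cong)
  have s: "?s \<xi> * exp (\<i> * complex_of_real (\<xi> \<bullet> y)) = (\<Prod>j\<in>UNIV. ?f y j (\<xi> $ j))" for \<xi> y
    unfolding exp_inner_vec Q monomial_def sum_negf[symmetric] exp_sum[OF finite_class.finite_UNIV]
      prod.distrib[symmetric] of_real_prod ..
  have f: "integrable lborel (?f y j)" for y j
    by (rule quartic_fourier_integrable[OF scaled_radius[OF t]])
  show "integrable lborel ?s"
    using integrable_prod_coords[of "?f 0", OF f] unfolding s[symmetric] by simp
  have "cofourier ?s x = (\<Prod>j\<in>UNIV. quartic_fourier t (quartic_coeff e t j) (q j) (x $ j))"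
    unfolding cofourier_def s integral_prod_coords[of "?f x", OF f] quartic_fourier_def ..
  also have "\<dots> = complex_of_real ((2 * pi) ^ CARD('n)) * heat e q t x"
    unfolding heat_def prod.distrib prod_constant mult.assoc[symmetric] of_real_power[symmetric]
      of_real_mult[symmetric] power_mult_distrib[symmetric]
    by simp
  finally show "cofourier ?s x = complex_of_real ((2 * pi) ^ CARD('n)) * heat e q t x" .
qed

text \<open>The multiplication formula, by Fubini.\<close>

lemma integral_mult_cofourier:
  fixes f g :: "real^'n::finite \<Rightarrow> complex"
  assumes f: "integrable lborel f" and g: "integrable lborel g"
  shows "(LINT \<xi>|lborel. f \<xi> * cofourier g \<xi>) = (LINT x|lborel. g x * cofourier f x)"
proof -
  let ?h = "\<lambda>\<xi> x. f \<xi> * g x * exp (\<i> * complex_of_real (x \<bullet> \<xi>))"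
  have [measurable]: "f \<in> borel_measurable borel" "g \<in> borel_measurable borel" using f g by simp_all
  have int: "integrable (lborel \<Otimes>\<^sub>M lborel) (case_prod ?h)"
    by (rule Bochner_Integration.integrable_bound[OF integrable_tensor[OF f g]])
       (auto simp: norm_mult)
  have "(LINT \<xi>|lborel. f \<xi> * cofourier g \<xi>) = (LINT \<xi>|lborel. LINT x|lborel. ?h \<xi> x)"
    unfolding cofourier_def by (simp add: mult.assoc)
  also have "\<dots> = (LINT x|lborel. LINT \<xi>|lborel. ?h \<xi> x)"
    by (rule lborel_pair.Fubini_integral[OF int, symmetric])
  also have "\<dots> = (LINT x|lborel. LINT \<xi>|lborel. g x * (f \<xi> * exp (\<i> * complex_of_real (\<xi> \<bullet> x))))"
    by (simp only: mult_ac inner_commute)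
  also have "\<dots> = (LINT x|lborel. g x * cofourier f x)"
    unfolding cofourier_def by simp
  finally show ?thesis .
qed

text \<open>Write \<open>1 / Q\<close> as the integral of \<open>exp (- (t * Q))\<close> over \<open>t > 0\<close>. The integral may be moved outside since
  the symbol acts absolutely integrably on the transform of \<open>\<psi>\<close>; then
  \<open>integral_mult_cofourier\<close> replaces the symbol by the heat kernel; and the integral over \<open>t\<close> is moved
  back inside because \<open>\<psi>\<close> vanishes near the origin, where the integral of the heat kernels over
  \<open>t\<close> need not converge.\<close>

lemma kernel_represents:
  fixes e :: "'n::finite" and T :: "(real^'n \<Rightarrow> complex) \<Rightarrow> complex"
  assumes T: "has_fourier_transform T (\<lambda>\<xi>. monomial q \<xi> / elliptic e \<xi>)"
    and l: "1 < late_decay q"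
    and \<psi>: "\<psi> \<in> test_functions (- {0})"
  shows "T \<psi> = dist_of_fun (kernel e q) \<psi>"
proof -
  let ?c = "complex_of_real (1 / (2 * pi) ^ CARD('n))"
  let ?Q = "elliptic e"
  let ?i = "\<lambda>t::real. complex_of_real (indicator {0<..} t)"
  have \<psi>U: "\<psi> \<in> test_functions UNIV" using \<psi> test_functions_mono by blast
  have int\<psi>: "integrable lborel \<psi>" by (rule test_functions_integrable[OF \<psi>U])
  have int_cof: "integrable lborel (cofourier \<psi>)" by (rule cofourier_integrable_self[OF \<psi>U])
  have [measurable]: "\<psi> \<in> borel_measurable borel" "cofourier \<psi> \<in> borel_measurable borel"
    using int\<psi> int_cof by simp_all
  have mon [measurable]: "monomial q \<in> borel_measurable borel"
    unfolding monomial_def by (intro borel_measurable_continuous_onI continuous_intros)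
  have ell [measurable]: "elliptic e \<in> borel_measurable borel"
    unfolding elliptic_def by (intro borel_measurable_continuous_onI continuous_intros)
  note has = has_fourier_transform_test_function[OF T \<psi>U]
  let ?F = "\<lambda>\<xi> t. complex_of_real (monomial q \<xi>) * cofourier \<psi> \<xi> * complex_of_real (indicator {0<..} t * exp (- (t * ?Q \<xi>)))"
  \<comment> \<open>At the origin the symbol is a division by zero and the integral over \<open>t\<close> may diverge.\<close>
  have ae: "AE \<xi> in lborel. \<xi> \<noteq> (0 :: real^'n)" by (rule AE_lborel_singleton)
  have inner: "has_bochner_integral lborel (\<lambda>t. complex_of_real (indicator {0<..} t * exp (- (t * ?Q \<xi>)))) (complex_of_real (1 / ?Q \<xi>))"
    if "\<xi> \<noteq> 0" for \<xi>
    by (rule has_bochner_integral_of_real[OF has_bochner_integral_exp[OF elliptic_pos[OF that]]])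
  have int1: "integrable (lborel \<Otimes>\<^sub>M lborel) (case_prod ?F)"
  proof (rule lborel_pair.Fubini_integrable)
    have eq: "(LINT t|lborel. norm (case_prod ?F (\<xi>, t))) = norm (complex_of_real (monomial q \<xi> / ?Q \<xi>) * cofourier \<psi> \<xi>)"
      if "\<xi> \<noteq> 0" for \<xi>
    proof -
      have "(LINT t|lborel. norm (case_prod ?F (\<xi>, t)))
        = (LINT t|lborel. norm (complex_of_real (monomial q \<xi>) * cofourier \<psi> \<xi>) * (indicator {0<..} t * exp (- (t * ?Q \<xi>))))"
        by (rule Bochner_Integration.integral_cong) (auto simp: norm_mult abs_mult)
      also have "\<dots> = norm (complex_of_real (monomial q \<xi>) * cofourier \<psi> \<xi>) * (1 / ?Q \<xi>)"
        using has_bochner_integral_integral_eq[OF has_bochner_integral_exp[OF elliptic_pos[OF that]]] by simp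
      finally show ?thesis using elliptic_pos[OF that, of e] by (simp add: norm_mult norm_divide)
    qed
    show "integrable lborel (\<lambda>\<xi>. LINT t|lborel. norm (case_prod ?F (\<xi>, t)))"
    proof (subst integrable_cong_AE)
      show "AE \<xi> in lborel. (LINT t|lborel. norm (case_prod ?F (\<xi>, t))) = norm (complex_of_real (monomial q \<xi> / ?Q \<xi>) * cofourier \<psi> \<xi>)"
        using ae by eventually_elim (rule eq)
      show "integrable lborel (\<lambda>\<xi>. norm (complex_of_real (monomial q \<xi> / ?Q \<xi>) * cofourier \<psi> \<xi>))"
        by (rule integrable_norm[OF has(1)])
    qed measurable
    show "AE \<xi> in lborel. integrable lborel (\<lambda>t. case_prod ?F (\<xi>, t))"
      using ae
    proof eventually_elim
      case (elim \<xi>)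
      then show ?case
        using inner[OF elim] by (simp only: prod.case) (intro integrable_mult_right, simp only: has_bochner_integral_iff)
    qed
  qed measurable
  have "(LINT \<xi>|lborel. complex_of_real (monomial q \<xi> / ?Q \<xi>) * cofourier \<psi> \<xi>) = (LINT \<xi>|lborel. LINT t|lborel. ?F \<xi> t)"
  proof (rule integral_cong_AE)
    show "AE \<xi> in lborel. complex_of_real (monomial q \<xi> / ?Q \<xi>) * cofourier \<psi> \<xi> = (LINT t|lborel. ?F \<xi> t)"
      using ae
    proof eventually_elim
      case (elim \<xi>)
      show ?case
        unfolding integral_mult_right_zero has_bochner_integral_integral_eq[OF inner[OF elim]]
        by simp
    qed
  qed measurable
  also have "\<dots> = (LINT t|lborel. LINT \<xi>|lborel. ?F \<xi> t)"
    by (rule lborel_pair.Fubini_integral[OF int1, symmetric])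
  also have "\<dots> = (LINT t|lborel. LINT x|lborel. complex_of_real ((2 * pi) ^ CARD('n)) * (\<psi> x * (?i t * heat e q t x)))"
  proof (rule Bochner_Integration.integral_cong[OF refl])
    fix t :: real
    show "(LINT \<xi>|lborel. ?F \<xi> t) = (LINT x|lborel. complex_of_real ((2 * pi) ^ CARD('n)) * (\<psi> x * (?i t * heat e q t x)))"
    proof (cases "0 < t")
      case True
      let ?s = "\<lambda>\<xi>. complex_of_real (monomial q \<xi> * exp (- (t * ?Q \<xi>)))"
      have "(LINT \<xi>|lborel. ?F \<xi> t) = (LINT \<xi>|lborel. ?s \<xi> * cofourier \<psi> \<xi>)"
        using True by (intro Bochner_Integration.integral_cong) (auto simp: mult_ac)
      also have "\<dots> = (LINT x|lborel. \<psi> x * cofourier ?s x)"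
        by (rule integral_mult_cofourier[OF heat_symbol_integrable[OF True] int\<psi>])
      also have "\<dots> = (LINT x|lborel. complex_of_real ((2 * pi) ^ CARD('n)) * (\<psi> x * (?i t * heat e q t x)))"
        unfolding heat_symbol_cofourier[OF True] using True
        by (intro Bochner_Integration.integral_cong) simp_all
      finally show ?thesis .
    qed simp
  qed
  also have "\<dots> = complex_of_real ((2 * pi) ^ CARD('n)) * (LINT t|lborel. LINT x|lborel. \<psi> x * (?i t * heat e q t x))"
    by simp
  also have "(LINT t|lborel. LINT x|lborel. \<psi> x * (?i t * heat e q t x)) = (LINT x|lborel. LINT t|lborel. \<psi> x * (?i t * heat e q t x))"
  proof (rule lborel_pair.Fubini_integral)
    \<comment> \<open>The minimum of the weight on the support of \<open>\<psi>\<close>.\<close>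
    obtain c where c: "c > 0" "\<And>x. \<psi> x \<noteq> 0 \<Longrightarrow> c \<le> weight e x"
    proof (cases "closure {x. \<psi> x \<noteq> 0} = {}")
      case True
      then have "\<psi> x = 0" for x by auto
      then show thesis by (intro that[of 1]) auto
    next
      case False
      have "compact (closure {x. \<psi> x \<noteq> 0})" "closure {x. \<psi> x \<noteq> 0} \<subseteq> - {0}"
        using \<psi> by (auto simp: test_functions_def)
      then obtain z where z: "z \<in> closure {x. \<psi> x \<noteq> 0}" "z \<noteq> 0"
          "\<And>x. x \<in> closure {x. \<psi> x \<noteq> 0} \<Longrightarrow> weight e z \<le> weight e x"
        using continuous_attains_inf[OF _ False weight_continuous[of _ e]] by blast
      show thesis
        using z weight_pos[of z e] closure_subset[of "{x. \<psi> x \<noteq> 0}"] by (intro that[of "weight e z"]) auto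
    qed
    obtain w where w: "integrable lborel w" "\<And>t. 0 \<le> w t"
      "\<And>t x. c \<le> weight e x \<Longrightarrow> norm (indicator {0<..} t *\<^sub>R heat e q t x) \<le> w t"
      using heat_dominated[OF l c(1), of e] by blast
    have tensor: "integrable (lborel \<Otimes>\<^sub>M lborel) (\<lambda>(x, t). \<psi> x * complex_of_real (w t))"
      by (rule integrable_tensor[OF int\<psi> integrable_of_real[OF w(1)]])
    show "integrable (lborel \<Otimes>\<^sub>M lborel) (\<lambda>(x, t). \<psi> x * (?i t * heat e q t x))"
    proof (rule Bochner_Integration.integrable_bound[OF tensor])
      show "AE z in lborel \<Otimes>\<^sub>M lborel. norm (case z of (x, t) \<Rightarrow> \<psi> x * (?i t * heat e q t x))
          \<le> norm (case z of (x, t) \<Rightarrow> \<psi> x * complex_of_real (w t))"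
      proof (rule AE_I2, clarify)
        fix x t
        show "norm (\<psi> x * (?i t * heat e q t x)) \<le> norm (\<psi> x * complex_of_real (w t))"
          using c(2)[of x] w(2)[of t] w(3)[of x t]
          by (cases "\<psi> x = 0") (auto simp: norm_mult intro!: mult_left_mono)
      qed
    qed measurable
  qed
  also have "(LINT x|lborel. LINT t|lborel. \<psi> x * (?i t * heat e q t x)) = dist_of_fun (kernel e q) \<psi>"
    unfolding dist_of_fun_def kernel_def by (simp add: scaleR_conv_of_real mult.commute)
  finally show ?thesis unfolding has(2) mult.assoc[symmetric] of_real_mult[symmetric] by simp
qed

lemma value_at_kernel:
  fixes e :: "'n::finite" and T :: "(real^'n \<Rightarrow> complex) \<Rightarrow> complex"
  assumes T: "has_fourier_transform T (\<lambda>\<xi>. monomial q \<xi> / elliptic e \<xi>)"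
    and l: "1 < late_decay q" and "x \<noteq> 0"
  shows "value_at T x = kernel e q x"
  using kernel_continuous[OF l] kernel_represents[OF T l] \<open>x \<noteq> 0\<close>
  by (intro value_at_eq) (auto simp: continuous_restriction_def)


section \<open>The three kernels\<close>

lemma decay_eq:
  "decay e q = real CARD('n) / 2 - 1 / 4 + (\<Sum>j\<in>UNIV. (if j = e then 1 / 4 else 1 / 2) * real (q j))"
  for e :: "'n::finite"
proof -
  have "(\<Sum>j\<in>(UNIV::'n set). (if j = e then 1 / 4 else 1 / 2) :: real)
     = (\<Sum>j\<in>UNIV. 1 / 2 - (if j = e then 1 / 4 else 0))"
    by (rule sum.cong) auto
  also have "\<dots> = real CARD('n) / 2 - 1 / 4" by (simp add: sum_subtractf)
  finally show ?thesis by (simp add: decay_def distrib_left sum.distrib)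
qed

lemma late_decay_eq:
  "late_decay q = real CARD('n) / 2 + (\<Sum>j\<in>UNIV. real (q j)) / 2" for q :: "'n::finite \<Rightarrow> nat"
  by (simp add: late_decay_def distrib_left sum.distrib sum_divide_distrib)

text \<open>On the unit ball the weight dominates the square of the norm, which compares the two logarithms.\<close>

lemma weight_on_ball:
  assumes "x \<in> ball 0 1 - {0}"
  shows "0 < weight e x" "weight e x \<le> 2" "\<bar>ln (weight e x)\<bar> \<le> 1 + 2 * \<bar>ln (norm x)\<bar>"
proof -
  have n: "0 < norm x" "norm x < 1" using assms by auto
  show pos: "0 < weight e x" using assms by (simp add: weight_pos)
  have sq: "(norm x)\<^sup>2 \<le> 1" using n by (simp add: power_le_one)
  have perp: "(perp_norm e x)\<^sup>2 \<le> 1" "(x $ e)\<^sup>2 \<le> 1"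
    using sq norm_sq_perp[of x e] zero_le_power2[of "x $ e"] zero_le_power2[of "perp_norm e x"] by linarith+
  have p1: "perp_norm e x \<le> 1" using perp(1) by (simp add: power2_le_imp_le[of _ 1])
  then show le2: "weight e x \<le> 2" using perp(2) by (simp add: weight_def)
  have "(perp_norm e x)\<^sup>2 \<le> perp_norm e x"
    using p1 perp_norm_nonneg[of e x] by (simp add: power2_eq_square mult_left_le)
  then have ge: "(norm x)\<^sup>2 \<le> weight e x" by (simp add: norm_sq_perp[of x e] weight_def)
  have "2 * ln (norm x) = ln ((norm x)\<^sup>2)" using n by (simp add: ln_realpow)
  also have "\<dots> \<le> ln (weight e x)" using ge n pos by (subst ln_le_cancel_iff) auto
  finally have lower: "2 * ln (norm x) \<le> ln (weight e x)" .
  have "ln (weight e x) \<le> ln 2" using le2 pos by (subst ln_le_cancel_iff) auto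
  also have "\<dots> \<le> 1" using ln_2_less_1 by simp
  finally show "\<bar>ln (weight e x)\<bar> \<le> 1 + 2 * \<bar>ln (norm x)\<bar>" using lower by linarith
qed

lemma value_at_bound:
  fixes e :: "'n::finite" and T :: "(real^'n \<Rightarrow> complex) \<Rightarrow> complex"
  assumes T: "has_fourier_transform T (\<lambda>\<xi>. monomial q \<xi> / elliptic e \<xi>)"
    and d: "1 \<le> decay e q" and l: "1 < late_decay q"
  obtains C where "C \<ge> 0" "\<And>x. x \<in> ball 0 1 - {0} \<Longrightarrow>
    weight e x powr (2 * decay e q - 2) * norm (value_at T x)
      \<le> C * (1 + of_bool (decay e q = 1) * \<bar>ln (norm x)\<bar>)"
proof -
  obtain C where C: "C \<ge> 0" "\<And>x. 0 < weight e x \<Longrightarrow> weight e x \<le> 2 \<Longrightarrow>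
    weight e x powr (2 * decay e q - 2) * norm (kernel e q x)
      \<le> C * (1 + of_bool (decay e q = 1) * \<bar>ln (weight e x)\<bar>)"
    using kernel_bound[OF d l] by blast
  show thesis
  \<comment> \<open>Comparing the logarithms costs \<open>1 + (1 + 2 L) = 2 (1 + L)\<close> instead of \<open>1 + L\<close>.\<close>
  proof (rule that[of "2 * C"])
    fix x :: "real^'n" assume x: "x \<in> ball 0 1 - {0}"
    note w = weight_on_ball[OF x, of e]
    have "weight e x powr (2 * decay e q - 2) * norm (value_at T x)
       \<le> C * (1 + of_bool (decay e q = 1) * \<bar>ln (weight e x)\<bar>)"
      using C(2)[OF w(1,2)] x by (simp add: value_at_kernel[OF T l])
    also have "\<dots> \<le> C * (2 * (1 + of_bool (decay e q = 1) * \<bar>ln (norm x)\<bar>))"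
      using w(3) by (intro mult_left_mono C) auto
    finally show "weight e x powr (2 * decay e q - 2) * norm (value_at T x)
       \<le> 2 * C * (1 + of_bool (decay e q = 1) * \<bar>ln (norm x)\<bar>)" by (simp only: mult_ac)
  qed (use C in simp)
qed

lemma monomial_axis: "monomial (\<lambda>j. if j = e then m else 0) \<xi> = (\<xi> $ e) ^ m"
proof -
  have "monomial (\<lambda>j. if j = e then m else 0) \<xi> = (\<Prod>j\<in>UNIV. if j = e then (\<xi> $ j) ^ m else 1)"
    unfolding monomial_def by (rule prod.cong) auto
  then show ?thesis by simp
qed

lemma monomial_add: "monomial (\<lambda>j. p j + q j) \<xi> = monomial p \<xi> * monomial q \<xi>"
  by (simp add: monomial_def power_add prod.distrib)

lemma sum_axis: "(\<Sum>j\<in>UNIV. c j * real (if j = e then m else 0)) = c e * real m" for e :: "'n::finite"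
  by (simp add: if_distrib[of real] if_distrib[of "\<lambda>x. _ * x"] cong: if_cong)

theorem theorem4:
  fixes e k :: "'n::finite"
    and H0 K0 Kk :: "(real^'n \<Rightarrow> complex) \<Rightarrow> complex"
  assumes "CARD('n) \<ge> 2"
    and "has_fourier_transform H0 (symbol_H0 e)"
    and "has_fourier_transform K0 (symbol_K0 e)"
    and "has_fourier_transform Kk (symbol_K e k)"
  shows "\<exists>A>0. \<forall>x\<in>ball (0::real^'n) 1 - {0}.
    ((x $ e)\<^sup>2 + perp_norm e x) powr (real CARD('n) - 2) * norm (value_at H0 x)
      \<le> A * (1 + of_bool (CARD('n) = 2) * \<bar>ln (norm x)\<bar>) \<and>
    ((x $ e)\<^sup>2 + perp_norm e x) powr (real CARD('n) - 3 / 2) * norm (value_at K0 x) \<le> A \<and>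
    ((x $ e)\<^sup>2 + perp_norm e x) powr (real CARD('n) - (1 + of_bool (k = e)) / 2)
      * norm (value_at Kk x) \<le> A"
proof -
  let ?N = "real CARD('n)"
  let ?pow = "\<lambda>i m j. if j = (i::'n) then m else (0::nat)"
  let ?q = "\<lambda>j. ?pow e 2 j + ?pow k 1 j"
  have N: "?N \<ge> 2" using assms(1) by simp
  have s: "symbol_H0 e = (\<lambda>\<xi>. monomial (?pow e 1) \<xi> / elliptic e \<xi>)"
    "symbol_K0 e = (\<lambda>\<xi>. monomial (?pow e 2) \<xi> / elliptic e \<xi>)"
    "symbol_K e k = (\<lambda>\<xi>. monomial ?q \<xi> / elliptic e \<xi>)"
    by (auto simp: fun_eq_iff symbol_H0_def symbol_K0_def symbol_K_def elliptic_def monomial_add monomial_axis)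
  \<comment> \<open>The exponents of the statement are \<open>2 * decay e q - 2\<close>; the value \<open>1\<close> occurs only for the first symbol with two coordinates.\<close>
  have d: "decay e (?pow e 1) = ?N / 2" "decay e (?pow e 2) = ?N / 2 + 1 / 4"
    "decay e ?q = ?N / 2 + 3 / 4 - of_bool (k = e) / 4"
    unfolding decay_eq of_nat_add distrib_left sum.distrib sum_axis by auto
  have one: "(\<Sum>j\<in>UNIV. real (?pow i m j)) = real m" for i m
    using sum_axis[of "\<lambda>_. 1" i m] by simp
  have l: "late_decay (?pow e 1) = ?N / 2 + 1 / 2" "late_decay (?pow e 2) = ?N / 2 + 1"
    "late_decay ?q = ?N / 2 + 3 / 2"
    unfolding late_decay_eq of_nat_add sum.distrib one by auto
  obtain C1 where C1: "C1 \<ge> 0" "\<And>x. x \<in> ball 0 1 - {0} \<Longrightarrow>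
     weight e x powr (?N - 2) * norm (value_at H0 x) \<le> C1 * (1 + of_bool (CARD('n) = 2) * \<bar>ln (norm x)\<bar>)"
  proof (rule value_at_bound[OF assms(2)[unfolded s]], goal_cases)
    case (3 C)
    then show ?case unfolding d by (intro 3(1)[of C]) auto
  qed (use N in \<open>auto simp: d l\<close>)
  obtain C2 where C2: "C2 \<ge> 0" "\<And>x. x \<in> ball 0 1 - {0} \<Longrightarrow>
     weight e x powr (?N - 3 / 2) * norm (value_at K0 x) \<le> C2"
  proof (rule value_at_bound[OF assms(3)[unfolded s]], goal_cases)
    case (3 C)
    have "?N / 2 + 1 / 4 \<noteq> 1" "2 * (?N / 2 + 1 / 4) - 2 = ?N - 3 / 2" using N by auto
    with 3 show ?case unfolding d by (intro 3(1)[of C]) auto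
  qed (use N in \<open>auto simp: d l\<close>)
  obtain C3 where C3: "C3 \<ge> 0" "\<And>x. x \<in> ball 0 1 - {0} \<Longrightarrow>
     weight e x powr (?N - (1 + of_bool (k = e)) / 2) * norm (value_at Kk x) \<le> C3"
  proof (rule value_at_bound[OF assms(4)[unfolded s]], goal_cases)
    case (3 C)
    have "?N / 2 + 3 / 4 - of_bool (k = e) / 4 \<noteq> 1"
      "2 * (?N / 2 + 3 / 4 - of_bool (k = e) / 4) - 2 = ?N - (1 + of_bool (k = e)) / 2"
      using N by (auto simp: of_bool_def)
    with 3 show ?case unfolding d by (intro 3(1)[of C]) auto
  qed (use N in \<open>auto simp: d l of_bool_def\<close>)
  show ?thesis
    unfolding weight_def[symmetric]
  proof (intro exI[of _ "C1 + C2 + C3 + 1"] conjI ballI)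
    fix x :: "real^'n" assume x: "x \<in> ball 0 1 - {0}"
    note C1(2)[OF x]
    also have "C1 * (1 + of_bool (CARD('n) = 2) * \<bar>ln (norm x)\<bar>)
        \<le> (C1 + C2 + C3 + 1) * (1 + of_bool (CARD('n) = 2) * \<bar>ln (norm x)\<bar>)"
      using C1 C2 C3 by (intro mult_right_mono) auto
    finally show "weight e x powr (?N - 2) * norm (value_at H0 x)
        \<le> (C1 + C2 + C3 + 1) * (1 + of_bool (CARD('n) = 2) * \<bar>ln (norm x)\<bar>)" .
    show "weight e x powr (?N - 3 / 2) * norm (value_at K0 x) \<le> C1 + C2 + C3 + 1"
      using C2(2)[OF x] C1(1) C3(1) by linarith
    show "weight e x powr (?N - (1 + of_bool (k = e)) / 2) * norm (value_at Kk x) \<le> C1 + C2 + C3 + 1"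
      using C3(2)[OF x] C1(1) C2(1) by linarith
  qed (use C1 C2 C3 in auto)
qed


end
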